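(* Let $\mathcal N,\mathcal M\in\mathrm{CPTP}(A\to B)$ and $r>0$. Then the error exponent under product strategies without quantum memory assistance satisfies $$\mathrm{E}^{\mathrm{er}}_{\mathrm{PRO}}(r|\mathcal N\|\mathcal M)\ge\sup_{0<\alpha<1}\frac{\alpha-1}{\alpha}\left[r-\bar d_\alpha(\mathcal N\|\mathcal M)\right].$$
   Context: All Hilbert spaces are finite-dimensional; $\mathfrak{D}(A)$ is the set of density operators on $A$, $\mathrm{CPTP}(A\to B)$ the set of quantum channels, $\log$ is base two. For $\alpha\in(0,1)$, $\bar D_\alpha(\rho\|\sigma)=\frac1{\alpha-1}\log\operatorname{Tr}[\rho^\alpha\sigma^{1-\alpha}]$ (Petz Rényi divergence, $+\infty$ if the trace vanishes), and $\bar d_\alpha(\mathcal N\|\mathcal M)=\sup_{\rho\in\mathfrak{D}(A)}\bar D_\alpha(\mathcal N(\rho)\|\mathcal M(\rho))$. A product strategy without quantum memory with $n$ channel uses consists of input states $\varphi_1,\dots,\varphi_n\in\mathfrak{D}(A)$ (possibly different) and a test $0\le\Pi_n\le I$ on $B^n$; its errors are $\alpha_n=\operatorname{Tr}[(I-\Pi_n)\bigotimes_{i=1}^n\mathcal N(\varphi_i)]$ (Type-I) and $\beta_n=\operatorname{Tr}[\Pi_n\bigotimes_{i=1}^n\mathcal M(\varphi_i)]$ (Type-II). The error exponent is $$\mathrm{E}^{\mathrm{er}}_{\mathrm{PRO}}(r|\mathcal N\|\mathcal M)=\sup\Big\{-\limsup_{n\to\infty}\frac1n\log\alpha_n:\ \limsup_{n\to\infty}\frac1n\log\beta_n\le-r\Big\},$$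 where the supremum is over all sequences (indexed by $n\in\mathbb N$) of product strategies satisfying the constraint. *)

theory Defs
  imports
    Complex_Main
    "HOL-Library.Extended_Real"
    "HOL-Library.Liminf_Limsup"
    "Jordan_Normal_Form.Matrix"
    "Jordan_Normal_Form.Schur_Decomposition"
begin

text \<open>Operators on a \<open>d\<close>-dimensional Hilbert space are complex \<open>d \<times> d\<close> matrices in a fixed
  orthonormal basis.\<close>

definition mat_trace :: "complex mat \<Rightarrow> complex" where
  "mat_trace A = (\<Sum>i<dim_row A. A $$ (i, i))"

text \<open>The order on \<^typ>\<open>complex\<close> is the one of \<^theory>\<open>HOL-Library.Complex_Order\<close>: \<open>0 \<le> z\<close> says
  that \<open>z\<close> is real and nonnegative, so positive semidefinite matrices are Hermitian.\<close>

definition psd :: "nat \<Rightarrow> complex mat \<Rightarrow> bool" where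
  "psd d A \<longleftrightarrow> A \<in> carrier_mat d d \<and> (\<forall>v \<in> carrier_vec d. 0 \<le> (A *\<^sub>v v) \<bullet>c v)"

definition density_ops :: "nat \<Rightarrow> complex mat set" where
  "density_ops d = {\<rho>. psd d \<rho> \<and> mat_trace \<rho> = 1}"

definition is_test :: "nat \<Rightarrow> complex mat \<Rightarrow> bool" where
  "is_test d T \<longleftrightarrow> psd d T \<and> psd d (1\<^sub>m d - T)"

definition tensor_mat :: "complex mat \<Rightarrow> complex mat \<Rightarrow> complex mat" where
  "tensor_mat A B = mat (dim_row A * dim_row B) (dim_col A * dim_col B)
     (\<lambda>(i, j). A $$ (i div dim_row B, j div dim_col B) * B $$ (i mod dim_row B, j mod dim_col B))"

fun tensor_list :: "complex mat list \<Rightarrow> complex mat" where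
  "tensor_list [] = 1\<^sub>m 1"
| "tensor_list (A # As) = tensor_mat A (tensor_list As)"

text \<open>A matrix \<open>X\<close> of size \<open>k * dA\<close> is read as a \<open>k \<times> k\<close> matrix of blocks of size \<open>dA\<close>
  (the same index convention as in \<^const>\<open>tensor_mat\<close>); the map \<open>id\<^sub>k \<otimes> N\<close> applies \<open>N\<close> to every block.\<close>

definition mat_block :: "nat \<Rightarrow> complex mat \<Rightarrow> nat \<Rightarrow> nat \<Rightarrow> complex mat" where
  "mat_block d X i j = mat d d (\<lambda>(p, q). X $$ (i * d + p, j * d + q))"

definition id_tensor ::
    "nat \<Rightarrow> nat \<Rightarrow> nat \<Rightarrow> (complex mat \<Rightarrow> complex mat) \<Rightarrow> complex mat \<Rightarrow> complex mat" where
  "id_tensor k dA dB N X = mat (k * dB) (k * dB)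
     (\<lambda>(i, j). N (mat_block dA X (i div dB) (j div dB)) $$ (i mod dB, j mod dB))"

text \<open>Maps are only constrained on \<^term>\<open>carrier_mat dA dA\<close>; their values elsewhere are never used.\<close>

definition CPTP :: "nat \<Rightarrow> nat \<Rightarrow> (complex mat \<Rightarrow> complex mat) set" where
  "CPTP dA dB = {N.
     (\<forall>X \<in> carrier_mat dA dA. N X \<in> carrier_mat dB dB) \<and>
     (\<forall>X \<in> carrier_mat dA dA. \<forall>Y \<in> carrier_mat dA dA. N (X + Y) = N X + N Y) \<and>
     (\<forall>c. \<forall>X \<in> carrier_mat dA dA. N (c \<cdot>\<^sub>m X) = c \<cdot>\<^sub>m N X) \<and>
     (\<forall>k X. psd (k * dA) X \<longrightarrow> psd (k * dB) (id_tensor k dA dB N X)) \<and>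
     (\<forall>X \<in> carrier_mat dA dA. mat_trace (N X) = mat_trace X)}"

text \<open>Powers of a positive semidefinite matrix by functional calculus. The result does not depend on
  the diagonalization chosen (lemma \<open>is_mat_powr_unique\<close>). As \<^prop>\<open>0 powr a = (0 :: real)\<close>, powers
  are taken on the support of the matrix.\<close>

definition is_mat_powr :: "complex mat \<Rightarrow> real \<Rightarrow> complex mat \<Rightarrow> bool" where
  "is_mat_powr A a P \<longleftrightarrow> (\<exists>U (d :: nat \<Rightarrow> real). let n = dim_row A in
     U \<in> carrier_mat n n \<and> mat_adjoint U * U = 1\<^sub>m n \<and>
     A = U * mat_diag n (\<lambda>i. complex_of_real (d i)) * mat_adjoint U \<and>
     P = U * mat_diag n (\<lambda>i. complex_of_real (d i powr a)) * mat_adjoint U)"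

definition mat_powr :: "complex mat \<Rightarrow> real \<Rightarrow> complex mat" where
  "mat_powr A a = (SOME P. is_mat_powr A a P)"

lemma is_mat_powr_unique:
  assumes "is_mat_powr A a P" "is_mat_powr A a Q"
  shows "P = Q"
proof -
  define n where "n = dim_row A"
  define D where "D f = mat_diag n (\<lambda>i. complex_of_real (f i))" for f :: "nat \<Rightarrow> real"
  obtain U d where U: "U \<in> carrier_mat n n" "mat_adjoint U * U = 1\<^sub>m n"
    "A = U * D d * mat_adjoint U" "P = U * D (\<lambda>i. d i powr a) * mat_adjoint U"
    using assms(1) unfolding is_mat_powr_def n_def D_def Let_def by blast
  obtain V e where V: "V \<in> carrier_mat n n" "mat_adjoint V * V = 1\<^sub>m n"
    "A = V * D e * mat_adjoint V" "Q = V * D (\<lambda>i. e i powr a) * mat_adjoint V"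
    using assms(2) unfolding is_mat_powr_def n_def D_def Let_def by blast
  have adj: "mat_adjoint U \<in> carrier_mat n n" "mat_adjoint V \<in> carrier_mat n n"
    using U(1) V(1) by (auto simp: mat_adjoint_def)
  have D: "D f \<in> carrier_mat n n" for f
    by (simp add: D_def)
  have UU: "U * mat_adjoint U = 1\<^sub>m n" and VV: "V * mat_adjoint V = 1\<^sub>m n"
    using mat_mult_left_right_inverse adj U(1,2) V(1,2) by blast+
  define W where "W = mat_adjoint V * U"
  have W: "W \<in> carrier_mat n n"
    using adj U(1) by (simp add: W_def)
  have compress: "mat_adjoint V * (X * Z * mat_adjoint X) * U
      = (mat_adjoint V * X) * Z * (mat_adjoint X * U)"
    if "X \<in> carrier_mat n n" "mat_adjoint X \<in> carrier_mat n n" "Z \<in> carrier_mat n n" for X Z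
    using that adj U(1) by (simp add: assoc_mult_mat[of _ n n _ n _ n])
  have *: "mat_adjoint V * (U * D f * mat_adjoint U) * U = W * D f" for f
    using compress[OF U(1) adj(1) D] U(2) right_mult_one_mat[OF mult_carrier_mat[OF W D]] by (simp add: W_def[symmetric])
  have **: "mat_adjoint V * (V * D f * mat_adjoint V) * U = D f * W" for f
    using compress[OF V(1) adj(2) D] V(2) left_mult_one_mat[OF D] by (simp add: W_def[symmetric])
  have "W * D d = D e * W"
    using *[of d] **[of e] U(3) V(3) by simp
  then have "mat n n (\<lambda>(i, j). W $$ (i, j) * complex_of_real (d j))
      = mat n n (\<lambda>(i, j). complex_of_real (e i) * W $$ (i, j))"
    using W by (simp add: D_def mat_diag_mult_left[of _ n n] mat_diag_mult_right[of _ n n])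
  then have "W $$ (i, j) * complex_of_real (d j) = complex_of_real (e i) * W $$ (i, j)"
    if "i < n" "j < n" for i j
    using that by (auto dest!: arg_cong[where f = "\<lambda>X. X $$ (i, j)"])
  then have entry: "W $$ (i, j) = 0 \<or> d j = e i" if "i < n" "j < n" for i j
    using that by fastforce
  have "W * D (\<lambda>i. d i powr a) = D (\<lambda>i. e i powr a) * W"
    using W entry
    by (auto simp: D_def mat_diag_mult_left[of _ n n] mat_diag_mult_right[of _ n n] intro!: eq_matI)
       (metis mult_zero_left mult_zero_right mult.commute)+
  then have eq: "mat_adjoint V * P * U = mat_adjoint V * Q * U"
    using * ** U(4) V(4) by simp
  have cancel: "V * (mat_adjoint V * X * U) * mat_adjoint U = X" if X: "X \<in> carrier_mat n n" for X
  proof -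
    have "V * (mat_adjoint V * X * U) * mat_adjoint U = (V * mat_adjoint V) * X * (U * mat_adjoint U)"
      using X adj U(1) V(1) by (simp add: assoc_mult_mat[of _ n n _ n _ n])
    then show ?thesis
      using X UU VV by simp
  qed
  have "P \<in> carrier_mat n n" "Q \<in> carrier_mat n n"
    using U(1,4) V(1,4) D adj by auto
  then show ?thesis
    using cancel eq by metis
qed

definition petz_div :: "real \<Rightarrow> complex mat \<Rightarrow> complex mat \<Rightarrow> ereal" where
  "petz_div \<alpha> \<rho> \<sigma> =
     (let t = Re (mat_trace (mat_powr \<rho> \<alpha> * mat_powr \<sigma> (1 - \<alpha>)))
      in if t = 0 then \<infinity> else ereal (1 / (\<alpha> - 1) * log 2 t))"

definition channel_petz_div ::
    "nat \<Rightarrow> real \<Rightarrow> (complex mat \<Rightarrow> complex mat) \<Rightarrow> (complex mat \<Rightarrow> complex mat) \<Rightarrow> ereal" where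
  "channel_petz_div dA \<alpha> N M = (SUP \<rho> \<in> density_ops dA. petz_div \<alpha> (N \<rho>) (M \<rho>))"

text \<open>Binary logarithm of a nonnegative real, with \<open>log 0 = -\<infinity>\<close>.\<close>

definition elog2 :: "real \<Rightarrow> ereal" where
  "elog2 x = (if x > 0 then ereal (log 2 x) else -\<infinity>)"

definition product_strategy ::
    "nat \<Rightarrow> nat \<Rightarrow> nat \<Rightarrow> (nat \<Rightarrow> complex mat) \<Rightarrow> complex mat \<Rightarrow> bool" where
  "product_strategy dA dB n \<phi> T \<longleftrightarrow> (\<forall>i<n. \<phi> i \<in> density_ops dA) \<and> is_test (dB ^ n) T"

definition product_output ::
    "(complex mat \<Rightarrow> complex mat) \<Rightarrow> nat \<Rightarrow> (nat \<Rightarrow> complex mat) \<Rightarrow> complex mat" where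
  "product_output N n \<phi> = tensor_list (map (\<lambda>i. N (\<phi> i)) [0..<n])"

definition type1_error ::
    "nat \<Rightarrow> (complex mat \<Rightarrow> complex mat) \<Rightarrow> nat \<Rightarrow> (nat \<Rightarrow> complex mat) \<Rightarrow> complex mat \<Rightarrow> real" where
  "type1_error dB N n \<phi> T = Re (mat_trace ((1\<^sub>m (dB ^ n) - T) * product_output N n \<phi>))"

definition type2_error ::
    "(complex mat \<Rightarrow> complex mat) \<Rightarrow> nat \<Rightarrow> (nat \<Rightarrow> complex mat) \<Rightarrow> complex mat \<Rightarrow> real" where
  "type2_error M n \<phi> T = Re (mat_trace (T * product_output M n \<phi>))"

text \<open>In a sequence of strategies, \<open>\<phi> n i\<close> is input \<open>i\<close> of the strategy with \<open>n\<close> channel uses, so the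
  inputs may change completely with \<open>n\<close>. The term for \<open>n = 0\<close> does not affect the upper limits.\<close>

definition error_exponent_PRO ::
    "nat \<Rightarrow> nat \<Rightarrow> real \<Rightarrow> (complex mat \<Rightarrow> complex mat) \<Rightarrow> (complex mat \<Rightarrow> complex mat) \<Rightarrow> ereal" where
  "error_exponent_PRO dA dB r N M =
     Sup {- limsup (\<lambda>n. ereal (1 / real n) * elog2 (type1_error dB N n (\<phi> n) (T n))) | \<phi> T.
           (\<forall>n. product_strategy dA dB n (\<phi> n) (T n)) \<and>
           limsup (\<lambda>n. ereal (1 / real n) * elog2 (type2_error M n (\<phi> n) (T n))) \<le> - ereal r}"

end

theory Submission
  imports Defs "Jordan_Normal_Form.Spectral_Radius"
begin

text \<open>Independent uses of one input \<open>\<phi>\<close> suffice. With \<open>\<rho> = N \<phi>\<close>, \<open>\<sigma> = M \<phi>\<close> and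
  \<open>t = Tr \<rho>\<^sup>\<alpha> \<sigma>\<^bsup>1-\<alpha>\<^esup>\<close>, the projection onto the positive part of \<open>\<rho>\<^bsup>\<otimes>n\<^esup> - c \<sigma>\<^bsup>\<otimes>n\<^esup>\<close> has, by the trace
  inequality of Audenaert et al., errors at most \<open>c\<^bsup>1-\<alpha>\<^esup> t\<^sup>n\<close> and \<open>c\<^bsup>-\<alpha>\<^esup> t\<^sup>n\<close>. The choice
  \<open>c = (t 2\<^sup>r)\<^bsup>n/\<alpha>\<^esup>\<close> turns the second bound into \<open>2\<^bsup>-rn\<^esup>\<close>, and the supremum over \<open>\<phi>\<close> gives the
  channel divergence. The trace inequality rests on the operator monotonicity of fractional powers
  (Loewner--Heinz), which is derived from midpoint convexity of the admissible exponents.\<close>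

section \<open>Adjoints, traces and positive semidefinite matrices\<close>

lemma mat_adjoint_dim [simp]:
  "dim_row (mat_adjoint A) = dim_col A" "dim_col (mat_adjoint A) = dim_row A"
  by (simp_all add: mat_adjoint_def)

lemma mat_adjoint_carrier [simp]:
  "A \<in> carrier_mat n m \<Longrightarrow> mat_adjoint A \<in> carrier_mat m n"
  by (intro carrier_matI) (simp_all only: mat_adjoint_dim carrier_matD)

lemma mat_adjoint_index [simp]:
  "i < dim_col A \<Longrightarrow> j < dim_row A \<Longrightarrow> mat_adjoint A $$ (i, j) = conjugate (A $$ (j, i))"
  by (simp add: mat_adjoint_def mat_of_rows_index)

lemma mat_adjoint_adjoint [simp]: "mat_adjoint (mat_adjoint A) = (A :: complex mat)"
  by (rule eq_matI) auto

lemma mat_adjoint_mult: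
  fixes A B :: "complex mat"
  assumes "A \<in> carrier_mat n m" "B \<in> carrier_mat m k"
  shows "mat_adjoint (A * B) = mat_adjoint B * mat_adjoint A"
  using assms by (intro eq_matI) (auto simp: scalar_prod_def intro!: sum.cong)

lemma mat_adjoint_minus:
  fixes A B :: "complex mat"
  assumes "A \<in> carrier_mat n m" "B \<in> carrier_mat n m"
  shows "mat_adjoint (A - B) = mat_adjoint A - mat_adjoint B"
  using assms by (intro eq_matI) auto

lemma mat_adjoint_one [simp]: "mat_adjoint (1\<^sub>m n) = (1\<^sub>m n :: complex mat)"
  by (rule eq_matI) auto

lemma mat_adjoint_mat_diag_of_real [simp]:
  "mat_adjoint (mat_diag n (\<lambda>i. complex_of_real (g i))) = mat_diag n (\<lambda>i. complex_of_real (g i))"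
  by (rule eq_matI) (auto simp: mat_diag_def)

lemma adjoint_inner_prod:
  fixes A :: "complex mat"
  assumes "A \<in> carrier_mat n m" "v \<in> carrier_vec m" "w \<in> carrier_vec n"
  shows "(A *\<^sub>v v) \<bullet>c w = v \<bullet>c (mat_adjoint A *\<^sub>v w)"
proof -
  have "(A *\<^sub>v v) \<bullet>c w = (\<Sum>i<n. \<Sum>j<m. A $$ (i, j) * v $ j * cnj (w $ i))"
    using assms by (auto simp: scalar_prod_def sum_distrib_right lessThan_atLeast0)
  also have "\<dots> = (\<Sum>j<m. \<Sum>i<n. A $$ (i, j) * v $ j * cnj (w $ i))"
    by (rule sum.swap)
  also have "\<dots> = v \<bullet>c (mat_adjoint A *\<^sub>v w)"
    using assms by (auto simp: scalar_prod_def sum_distrib_left lessThan_atLeast0 mult_ac)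
  finally show ?thesis .
qed

lemma psd_carrier: "psd n A \<Longrightarrow> A \<in> carrier_mat n n"
  by (simp add: psd_def)

lemma psd_add:
  assumes "psd n A" "psd n B"
  shows "psd n (A + B)"
  using assms unfolding psd_def
  by (auto simp: add_mult_distrib_mat_vec[of _ n n] add_scalar_prod_distrib[of _ n] intro: add_nonneg_nonneg)

lemma psd_smult:
  assumes "psd n A" "c \<ge> 0"
  shows "psd n (complex_of_real c \<cdot>\<^sub>m A)"
proof -
  have "(complex_of_real c \<cdot>\<^sub>m A *\<^sub>v v) \<bullet>c v = complex_of_real c * ((A *\<^sub>v v) \<bullet>c v)"
    if "v \<in> carrier_vec n" for v
    using that assms by (auto simp: psd_def scalar_prod_def mult_mat_vec_def sum_distrib_left sum_distrib_right mult_ac)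
  moreover have "0 \<le> complex_of_real c" using assms by (simp add: less_eq_complex_def)
  ultimately show ?thesis using assms by (auto simp: psd_def intro!: mult_nonneg_nonneg)
qed

text \<open>The form of the congruent matrix at \<open>v\<close> is the form of \<open>A\<close> at
  \<open>Z *\<^sub>v v\<close>.\<close>

lemma psd_congruence:
  assumes "psd n A" "Z \<in> carrier_mat n m"
  shows "psd m (mat_adjoint Z * A * Z)"
  unfolding psd_def
proof (intro conjI ballI)
  have A: "A \<in> carrier_mat n n" using psd_carrier[OF assms(1)] .
  show "mat_adjoint Z * A * Z \<in> carrier_mat m m"
    using assms(2) A by (intro mult_carrier_mat[of _ m n] mat_adjoint_carrier)
  fix v :: "complex vec" assume v: "v \<in> carrier_vec m"
  define w where "w = Z *\<^sub>v v"
  have w: "w \<in> carrier_vec n" using v assms(2) by (simp add: w_def)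
  have "mat_adjoint Z * A * Z *\<^sub>v v = mat_adjoint Z *\<^sub>v (A *\<^sub>v w)"
    using assms v A
    by (simp add: w_def assoc_mult_mat_vec[of _ m n _ m] assoc_mult_mat_vec[of _ n n _ m] assoc_mult_mat[of _ m n _ n _ m] mult_carrier_mat[of _ n n])
  moreover have "(mat_adjoint Z *\<^sub>v (A *\<^sub>v w)) \<bullet>c v = (A *\<^sub>v w) \<bullet>c w"
    using adjoint_inner_prod[of "mat_adjoint Z" m n "A *\<^sub>v w" v] A v w assms(2) by (simp flip: w_def)
  ultimately show "0 \<le> (mat_adjoint Z * A * Z *\<^sub>v v) \<bullet>c v"
    using assms(1) w unfolding psd_def by simp
qed

lemma psd_one: "psd n (1\<^sub>m n)"
  unfolding psd_def
proof (intro conjI ballI)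
  fix v :: "complex vec" assume "v \<in> carrier_vec n"
  then have "1\<^sub>m n *\<^sub>v v = v" by (rule one_mult_mat_vec)
  then show "0 \<le> (1\<^sub>m n *\<^sub>v v) \<bullet>c v" by (simp only: conjugate_square_ge_0_vec)
qed simp

lemma psd_gram:
  assumes "Z \<in> carrier_mat n m"
  shows "psd m (mat_adjoint Z * Z)"
  using psd_congruence[OF psd_one assms] right_mult_one_mat[OF mat_adjoint_carrier[OF assms]] by simp

lemma mult_unit_vec:
  fixes A :: "complex mat"
  assumes "A \<in> carrier_mat n m" "i < m"
  shows "A *\<^sub>v unit_vec m i = col A i"
  using assms by (intro eq_vecI) auto

lemma psd_diag:
  assumes "psd n A" "i < n"
  shows "0 \<le> A $$ (i, i)"
proof -
  have "0 \<le> (A *\<^sub>v unit_vec n i) \<bullet>c unit_vec n i"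
    using assms by (auto simp: psd_def)
  also have "conjugate (unit_vec n i) = (unit_vec n i :: complex vec)"
    by (intro eq_vecI) (auto simp: unit_vec_def)
  finally show ?thesis using assms mult_unit_vec[OF psd_carrier[OF assms(1)] assms(2)] psd_carrier[OF assms(1)] by simp
qed

text \<open>Polarisation: the form is real at every vector e_i + c e_j, and c = 1 and c = i already
  determine the imaginary and the real part of the difference between entry (i, j) and the conjugate
  of entry (j, i).\<close>

lemma psd_hermitian:
  assumes "psd n A"
  shows "mat_adjoint A = A"
proof (rule eq_matI)
  have A: "A \<in> carrier_mat n n" by (rule psd_carrier[OF assms])
  fix i j assume "i < dim_row A" "j < dim_col A"
  then have ij: "i < n" "j < n" using A by auto
  \<comment> \<open>The quadratic form of \<open>A\<close> at e_i + c e_j, expanded.\<close>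
  define q where "q c = A $$ (i,i) + c * A $$ (i,j) + cnj c * A $$ (j,i) + c * cnj c * A $$ (j,j)" for c
  have q: "Im (q c) = 0" for c
  proof -
    define v where "v = unit_vec n i + c \<cdot>\<^sub>v unit_vec n j"
    have v: "v \<in> carrier_vec n" by (simp add: v_def)
    have "A *\<^sub>v v = col A i + c \<cdot>\<^sub>v col A j"
      using A ij by (simp add: v_def mult_add_distrib_mat_vec[of _ n n] mult_mat_vec[of _ n n] mult_unit_vec)
    moreover have "conjugate v = unit_vec n i + cnj c \<cdot>\<^sub>v unit_vec n j"
      by (intro eq_vecI) (auto simp: v_def unit_vec_def)
    ultimately have "(A *\<^sub>v v) \<bullet>c v = q c"
      using A ij by (simp add: q_def scalar_prod_add_distrib[of _ n] add_scalar_prod_distrib[of _ n] algebra_simps)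
    moreover have "0 \<le> (A *\<^sub>v v) \<bullet>c v" using assms v by (simp add: psd_def)
    ultimately show ?thesis by (simp add: less_eq_complex_def)
  qed
  have "Im (A $$ (i,i)) = 0" "Im (A $$ (j,j)) = 0"
    using psd_diag[OF assms] ij by (auto simp: less_eq_complex_def)
  then have "A $$ (i, j) = cnj (A $$ (j, i))"
    using q[of 1] q[of \<i>] by (auto simp: q_def complex_eq_iff)
  then show "mat_adjoint A $$ (i, j) = A $$ (i, j)" using A ij by simp
qed (use psd_carrier[OF assms] in auto)

lemma mat_trace_add:
  "A \<in> carrier_mat n n \<Longrightarrow> B \<in> carrier_mat n n \<Longrightarrow> mat_trace (A + B) = mat_trace A + mat_trace B"
  by (simp add: mat_trace_def sum.distrib)

lemma mat_trace_minus:
  "A \<in> carrier_mat n n \<Longrightarrow> B \<in> carrier_mat n n \<Longrightarrow> mat_trace (A - B) = mat_trace A - mat_trace B"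
  by (simp add: mat_trace_def sum_subtractf)

lemma mat_trace_smult:
  "mat_trace (c \<cdot>\<^sub>m A) = c * mat_trace A" if "A \<in> carrier_mat n n"
  using that by (simp add: mat_trace_def sum_distrib_left)

lemma mat_trace_comm:
  assumes "A \<in> carrier_mat n m" "B \<in> carrier_mat m n"
  shows "mat_trace (A * B) = mat_trace (B * A)"
proof -
  have "mat_trace (A * B) = (\<Sum>i<n. \<Sum>j<m. A $$ (i, j) * B $$ (j, i))"
    using assms by (auto simp: mat_trace_def scalar_prod_def lessThan_atLeast0)
  also have "\<dots> = (\<Sum>j<m. \<Sum>i<n. A $$ (i, j) * B $$ (j, i))"
    by (rule sum.swap)
  also have "\<dots> = mat_trace (B * A)"
    using assms by (auto simp: mat_trace_def scalar_prod_def lessThan_atLeast0 mult_ac)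
  finally show ?thesis .
qed

lemma psd_trace: "psd n A \<Longrightarrow> 0 \<le> mat_trace A"
  unfolding mat_trace_def by (rule sum_nonneg, rule psd_diag) (use psd_carrier in blast)+

text \<open>With all dimensions fixed to \<open>n\<close>, the carrier premises contain no
  undetermined dimension, so conditional rewriting can discharge them. The same holds for
  \<open>square_distrib\<close>.\<close>

lemmas square_assoc = assoc_mult_mat[of _ n n _ n _ n] for n

lemma square_mult_carrier [simp]:
  "A \<in> carrier_mat n n \<Longrightarrow> B \<in> carrier_mat n n \<Longrightarrow> A * B \<in> carrier_mat n n"
  by (rule mult_carrier_mat)

lemmas square_distrib =
  mult_add_distrib_mat[of _ n n _ n] add_mult_distrib_mat[of _ n n _ _ n]
  mult_minus_distrib_mat[of _ n n _ n] minus_mult_distrib_mat[of _ n n _ _ n]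
  mult_smult_distrib[of _ n n _ n] mult_smult_assoc_mat[of _ n n _ n] for n

section \<open>Functions of diagonalised matrices\<close>

definition unitary :: "nat \<Rightarrow> complex mat \<Rightarrow> bool" where
  "unitary n U \<longleftrightarrow> U \<in> carrier_mat n n \<and> mat_adjoint U * U = 1\<^sub>m n"

text \<open>Functional calculus in a fixed eigenbasis: the columns of \<open>U\<close> are the
  eigenvectors and \<open>g\<close> lists the eigenvalues. Algebra on functions of one matrix
  thereby becomes pointwise algebra on \<open>g\<close>. Values of \<open>g\<close> from index
  \<open>n\<close> on are irrelevant.\<close>

definition fdiag :: "nat \<Rightarrow> complex mat \<Rightarrow> (nat \<Rightarrow> real) \<Rightarrow> complex mat" where
  "fdiag n U g = U * mat_diag n (\<lambda>i. complex_of_real (g i)) * mat_adjoint U"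

lemma unitary_carrier: "unitary n U \<Longrightarrow> U \<in> carrier_mat n n"
  by (simp add: unitary_def)

lemma unitary_mult_adjoint:
  assumes "unitary n U"
  shows "U * mat_adjoint U = 1\<^sub>m n"
  using mat_mult_left_right_inverse[of "mat_adjoint U" n U] assms by (simp add: unitary_def)

lemma unitary_mult:
  assumes "unitary n U" "unitary n V"
  shows "unitary n (U * V)"
proof -
  have c: "U \<in> carrier_mat n n" "V \<in> carrier_mat n n" using assms by (auto simp: unitary_def)
  have "mat_adjoint (U * V) * (U * V) = mat_adjoint V * (mat_adjoint U * U) * V"
    using c by (simp add: mat_adjoint_mult[OF c] square_assoc[where n=n])
  also have "\<dots> = 1\<^sub>m n"
    using assms c right_mult_one_mat[OF mat_adjoint_carrier[OF c(2)]] by (simp add: unitary_def)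
  finally show ?thesis using c by (simp add: unitary_def)
qed

lemma fdiag_carrier [simp]: "U \<in> carrier_mat n n \<Longrightarrow> fdiag n U g \<in> carrier_mat n n"
  by (simp add: fdiag_def)

lemma fdiag_cong: "(\<And>i. i < n \<Longrightarrow> g i = h i) \<Longrightarrow> fdiag n U g = fdiag n U h"
  unfolding fdiag_def mat_diag_def by (intro arg_cong2[where f = "(*)"] eq_matI refl) auto

lemma fdiag_mult:
  assumes "unitary n U"
  shows "fdiag n U g * fdiag n U h = fdiag n U (\<lambda>i. g i * h i)"
proof -
  have U: "U \<in> carrier_mat n n" using assms by (simp add: unitary_def)
  let ?D = "\<lambda>g. mat_diag n (\<lambda>i. complex_of_real (g i))"
  have "fdiag n U g * fdiag n U h = U * ?D g * (mat_adjoint U * U) * ?D h * mat_adjoint U"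
    using U by (simp add: fdiag_def square_assoc[where n=n])
  also have "\<dots> = U * (?D g * ?D h) * mat_adjoint U"
    using U assms by (simp add: unitary_def right_mult_one_mat[of _ n n] left_mult_one_mat[of _ n n] square_assoc[where n=n] del: mat_diag_diag)
  finally show ?thesis by (simp add: fdiag_def)
qed

lemma fdiag_add:
  assumes "U \<in> carrier_mat n n"
  shows "fdiag n U g + fdiag n U h = fdiag n U (\<lambda>i. g i + h i)"
proof -
  let ?D = "\<lambda>g. mat_diag n (\<lambda>i. complex_of_real (g i))"
  have D: "?D (\<lambda>i. g i + h i) = ?D g + ?D h" by (rule eq_matI) (auto simp: mat_diag_def)
  show ?thesis unfolding fdiag_def D
    using assms by (simp add: square_distrib[where n=n])
qed

lemma fdiag_smult:
  assumes "U \<in> carrier_mat n n"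
  shows "complex_of_real c \<cdot>\<^sub>m fdiag n U g = fdiag n U (\<lambda>i. c * g i)"
proof -
  let ?D = "\<lambda>g. mat_diag n (\<lambda>i. complex_of_real (g i))"
  have D: "?D (\<lambda>i. c * g i) = complex_of_real c \<cdot>\<^sub>m ?D g" by (rule eq_matI) (auto simp: mat_diag_def)
  show ?thesis unfolding fdiag_def D
    using assms by (simp add: square_distrib[where n=n])
qed

lemma fdiag_minus:
  assumes "U \<in> carrier_mat n n"
  shows "fdiag n U g - fdiag n U h = fdiag n U (\<lambda>i. g i - h i)"
proof -
  let ?D = "\<lambda>g. mat_diag n (\<lambda>i. complex_of_real (g i))"
  have D: "?D (\<lambda>i. g i - h i) = ?D g - ?D h" by (rule eq_matI) (auto simp: mat_diag_def)
  show ?thesis unfolding fdiag_def D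
    using assms by (simp add: square_distrib[where n=n])
qed

lemma fdiag_one: "unitary n U \<Longrightarrow> fdiag n U (\<lambda>i. 1) = 1\<^sub>m n"
  using unitary_mult_adjoint[of n U] by (simp add: fdiag_def unitary_def right_mult_one_mat[of U n n])

lemma fdiag_adjoint:
  assumes "U \<in> carrier_mat n n"
  shows "mat_adjoint (fdiag n U g) = fdiag n U g"
  unfolding fdiag_def using assms
  by (subst mat_adjoint_mult[of _ n n _ n], simp, simp, subst mat_adjoint_mult[of _ n n _ n])
     (simp_all add: square_assoc[where n=n])

lemma fdiag_psd:
  assumes "U \<in> carrier_mat n n" "\<And>i. i < n \<Longrightarrow> g i \<ge> 0"
  shows "psd n (fdiag n U g)"
proof -
  let ?D = "\<lambda>g. mat_diag n (\<lambda>i. complex_of_real (g i))"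
  have "psd n (?D g)"
  proof -
    have "?D g = mat_adjoint (?D (\<lambda>i. sqrt (g i))) * ?D (\<lambda>i. sqrt (g i))"
      using assms(2) by (simp, intro eq_matI) (auto simp: mat_diag_def simp flip: of_real_mult)
    then show ?thesis using psd_gram[of "?D (\<lambda>i. sqrt (g i))" n n] by simp
  qed
  from psd_congruence[OF this, of "mat_adjoint U" n] show ?thesis
    using assms by (simp add: fdiag_def)
qed

lemma fdiag_compress:
  assumes "unitary n U"
  shows "mat_adjoint U * fdiag n U g * U = mat_diag n (\<lambda>i. complex_of_real (g i))"
proof -
  have U: "U \<in> carrier_mat n n" using assms by (simp add: unitary_def)
  let ?D = "mat_diag n (\<lambda>i. complex_of_real (g i))"
  have "mat_adjoint U * fdiag n U g * U = (mat_adjoint U * U) * ?D * (mat_adjoint U * U)"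
    using U by (simp add: fdiag_def square_assoc[where n=n])
  then show ?thesis using assms by (simp add: unitary_def left_mult_one_mat[of _ n n] right_mult_one_mat[of _ n n])
qed

text \<open>Undoing the change of basis leaves a positive semidefinite diagonal matrix whose
  diagonal is \<open>g\<close>.\<close>

lemma psd_fdiag_nonneg:
  assumes "unitary n U" "psd n (fdiag n U g)" "i < n"
  shows "g i \<ge> 0"
proof -
  have "psd n (mat_diag n (\<lambda>i. complex_of_real (g i)))"
    using psd_congruence[OF assms(2) unitary_carrier[OF assms(1)]] by (simp add: fdiag_compress[OF assms(1)])
  from psd_diag[OF this assms(3)] show ?thesis using assms(3) by (simp add: mat_diag_def less_eq_complex_def)
qed

text \<open>In eigenbasis coordinates the form is a finite sum that is linear in \<open>g\<close>.
  This serves to show that it depends continuously on the exponent when \<open>g\<close> consists of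
  powers.\<close>

lemma fdiag_inner_prod:
  assumes "U \<in> carrier_mat n n" "v \<in> carrier_vec n"
  shows "(fdiag n U g *\<^sub>v v) \<bullet>c v
    = (\<Sum>i<n. complex_of_real (g i) * ((mat_adjoint U *\<^sub>v v) $ i * cnj ((mat_adjoint U *\<^sub>v v) $ i)))"
proof -
  let ?D = "mat_diag n (\<lambda>i. complex_of_real (g i))"
  define w where "w = mat_adjoint U *\<^sub>v v"
  have w: "w \<in> carrier_vec n" using assms by (simp add: w_def mult_mat_vec_carrier[of _ n n])
  have "(fdiag n U g *\<^sub>v v) \<bullet>c v = (U *\<^sub>v (?D *\<^sub>v w)) \<bullet>c v"
    using assms w by (simp add: fdiag_def w_def assoc_mult_mat_vec[of _ n n _ n])
  also have "\<dots> = (?D *\<^sub>v w) \<bullet>c w"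
    unfolding w_def using assms by (intro adjoint_inner_prod) (auto intro!: mult_mat_vec_carrier[of _ n n])
  also have "(?D *\<^sub>v w) = vec n (\<lambda>i. complex_of_real (g i) * w $ i)"
  proof (rule eq_vecI)
    fix i assume i: "i < dim_vec (vec n (\<lambda>i. complex_of_real (g i) * w $ i))"
    then have "(?D *\<^sub>v w) $ i = (\<Sum>j<n. (if i = j then complex_of_real (g j) else 0) * w $ j)"
      using w by (auto simp: mat_diag_def scalar_prod_def lessThan_atLeast0 intro!: sum.cong)
    also have "\<dots> = (\<Sum>j<n. if i = j then complex_of_real (g j) * w $ j else 0)"
      by (rule sum.cong) auto
    finally show "(?D *\<^sub>v w) $ i = vec n (\<lambda>i. complex_of_real (g i) * w $ i) $ i"
      using i by (simp)
  qed (simp add: mat_diag_def)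
  finally show ?thesis using w by (simp add: w_def[symmetric] scalar_prod_def lessThan_atLeast0 mult_ac)
qed

section \<open>The spectral theorem\<close>

text \<open>Complete \<open>v\<close> to a basis, orthogonalise with Gram-Schmidt, which keeps the
  first vector, and normalise. The scalar \<open>c\<close> records the normalisation of
  \<open>v\<close>.\<close>

lemma unitary_completion:
  assumes v: "v \<in> carrier_vec n" "v \<noteq> 0\<^sub>v n"
  obtains W c where "unitary n W" "col W 0 = c \<cdot>\<^sub>v v"
proof -
  interpret cof_vec_space n "TYPE(complex)" .
  define b where "b = basis_completion v"
  define ws where "ws = gram_schmidt n b"
  from basis_completion[OF v, folded b_def]
  have b: "distinct b" "\<not> lin_dep (set b)" "set b \<subseteq> carrier_vec n" "hd b = v" "length b = n"
    by auto
  have n: "n > 0" using v by (cases n) auto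
  then obtain vs where bv: "b = v # vs" using b(4,5) by (cases b) auto
  from gram_schmidt_result[OF b(3,1,2) refl, folded ws_def]
  have ws: "set ws \<subseteq> carrier_vec n" "corthogonal ws" "length ws = n"
    by (auto simp: b(5))
  have "hd ws = v" using gram_schmidt_hd[OF v(1), of vs, folded bv] unfolding ws_def .
  then have ws0: "ws ! 0 = v" using hd_conv_nth[of ws] ws(3) n by fastforce
  have wsc: "ws ! i \<in> carrier_vec n" if "i < n" for i using ws that by auto
  \<comment> \<open>The reciprocal norm of the orthogonal vector \<open>ws ! j\<close>.\<close>
  define f where "f j = complex_of_real (1 / sqrt (Re (ws ! j \<bullet>c ws ! j)))" for j
  define W where "W = mat n n (\<lambda>(i, j). f j * ws ! j $ i)"
  have W: "W \<in> carrier_mat n n" by (simp add: W_def)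
  have "mat_adjoint W * W = 1\<^sub>m n"
  proof (rule eq_matI)
    fix i j assume "i < dim_row (1\<^sub>m n :: complex mat)" "j < dim_col (1\<^sub>m n :: complex mat)"
    then have ij: "i < n" "j < n" by auto
    have "(mat_adjoint W * W) $$ (i, j) = (\<Sum>k<n. cnj (f i * ws ! i $ k) * (f j * ws ! j $ k))"
      using ij W by (simp add: scalar_prod_def lessThan_atLeast0 W_def)
    also have "\<dots> = cnj (f i) * f j * (\<Sum>k<n. ws ! j $ k * cnj (ws ! i $ k))"
      by (simp add: sum_distrib_left mult_ac)
    also have "(\<Sum>k<n. ws ! j $ k * cnj (ws ! i $ k)) = ws ! j \<bullet>c ws ! i"
      using wsc[OF ij(1)] by (simp add: scalar_prod_def lessThan_atLeast0)
    finally have *: "(mat_adjoint W * W) $$ (i, j) = cnj (f i) * f j * (ws ! j \<bullet>c ws ! i)" .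
    show "(mat_adjoint W * W) $$ (i, j) = 1\<^sub>m n $$ (i, j)"
    proof (cases "i = j")
      case False
      then have "ws ! j \<bullet>c ws ! i = 0" using ws ij unfolding corthogonal_def by auto
      then show ?thesis using * False ij by simp
    next
      case True
      have ne: "ws ! i \<bullet>c ws ! i \<noteq> 0" using corthogonalD[OF ws(2), of i i] ij ws(3) by auto
      have "0 \<le> ws ! i \<bullet>c ws ! i" by (rule conjugate_square_ge_0_vec)
      with ne obtain q where q: "ws ! i \<bullet>c ws ! i = complex_of_real q" "q > 0"
        by (intro that[of "Re (ws ! i \<bullet>c ws ! i)"]) (auto simp: less_eq_complex_def complex_eq_iff)
      have "cnj (f i) * f i * complex_of_real q = complex_of_real (1 / sqrt q * (1 / sqrt q) * q)"
        unfolding f_def q(1) by (simp only: complex_cnj_complex_of_real of_real_mult Re_complex_of_real)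
      also have "1 / sqrt q * (1 / sqrt q) * q = 1" using q(2) by simp
      finally show ?thesis using * True ij q(1) by simp
    qed
  qed (use W in auto)
  moreover have "col W 0 = f 0 \<cdot>\<^sub>v v"
    using n v(1) by (intro eq_vecI) (auto simp: W_def ws0)
  ultimately show ?thesis using that W by (auto simp: unitary_def)
qed

lemma fdiag_conjugate:
  assumes "W \<in> carrier_mat n n" "V \<in> carrier_mat n n"
  shows "W * fdiag n V d * mat_adjoint W = fdiag n (W * V) d"
  using assms by (simp add: fdiag_def mat_adjoint_mult[of _ n n _ n] square_assoc[where n=n])

lemma unitary_cancel:
  assumes "unitary n W" "A \<in> carrier_mat n n"
  shows "W * (mat_adjoint W * A * W) * mat_adjoint W = A"
proof -
  have W: "W \<in> carrier_mat n n" using assms by (simp add: unitary_def)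
  have "W * (mat_adjoint W * A * W) * mat_adjoint W = (W * mat_adjoint W) * A * (W * mat_adjoint W)"
    using W assms(2) by (simp add: square_assoc[where n=n])
  then show ?thesis using assms by (simp add: unitary_mult_adjoint)
qed

text \<open>Induction on the dimension. In a unitary basis starting with an eigenvector the first
  column vanishes below the diagonal; by hermiticity so does the rest of the first row, and the
  remaining block is Hermitian of smaller size.\<close>

theorem hermitian_diagonalizable:
  assumes "A \<in> carrier_mat n n" "mat_adjoint A = A"
  shows "\<exists>U d. unitary n U \<and> A = fdiag n U d"
  using assms
proof (induction n arbitrary: A)
  case 0
  have "unitary 0 (1\<^sub>m 0)" by (auto simp: unitary_def)
  moreover have "A = fdiag 0 (1\<^sub>m 0) (\<lambda>_. 0)"
    using 0 by (intro eq_matI) (auto simp: fdiag_def)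
  ultimately show ?case by blast
next
  case (Suc n)
  note A = Suc.prems(1)
  obtain e where "eigenvalue A e"
    using spectrum_non_empty[OF A] by (auto simp: spectrum_def)
  then obtain v where v: "v \<in> carrier_vec (Suc n)" "v \<noteq> 0\<^sub>v (Suc n)" "A *\<^sub>v v = e \<cdot>\<^sub>v v"
    using A by (auto simp: eigenvalue_def eigenvector_def)
  obtain W c where W: "unitary (Suc n) W" "col W 0 = c \<cdot>\<^sub>v v"
    by (rule unitary_completion[OF v(1,2)])
  have Wc: "W \<in> carrier_mat (Suc n) (Suc n)" using W by (simp add: unitary_def)
  define A' where "A' = mat_adjoint W * A * W"
  have A': "A' \<in> carrier_mat (Suc n) (Suc n)" using Wc A by (simp add: A'_def)
  have adj: "mat_adjoint A' = A'"
    unfolding A'_def using Wc A Suc.prems(2)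
    by (simp add: mat_adjoint_mult[of _ "Suc n" "Suc n" _ "Suc n"] square_assoc[where n="Suc n"])
  have herm: "A' $$ (i, j) = cnj (A' $$ (j, i))" if "i < Suc n" "j < Suc n" for i j
  proof -
    have "mat_adjoint A' $$ (i, j) = cnj (A' $$ (j, i))" using A' that by simp
    then show ?thesis by (simp add: adj)
  qed
  have "col A' 0 = col (mat_adjoint W * (A * W)) 0"
    using A Wc by (simp only: A'_def square_assoc[where n="Suc n"] mat_adjoint_carrier)
  also have "\<dots> = mat_adjoint W *\<^sub>v col (A * W) 0"
    by (rule col_mult2[OF mat_adjoint_carrier[OF Wc] square_mult_carrier[OF A Wc]]) simp
  also have "col (A * W) 0 = A *\<^sub>v col W 0"
    by (rule col_mult2[OF A Wc]) simp
  also have "mat_adjoint W *\<^sub>v (A *\<^sub>v col W 0) = mat_adjoint W *\<^sub>v (e \<cdot>\<^sub>v col W 0)"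
    using A v by (simp add: W(2) mult_mat_vec[of _ "Suc n" "Suc n"] smult_smult_assoc mult.commute)
  also have "\<dots> = e \<cdot>\<^sub>v (mat_adjoint W *\<^sub>v col W 0)"
    by (rule mult_mat_vec[OF mat_adjoint_carrier[OF Wc]]) (use W(2) v in simp)
  also have "mat_adjoint W *\<^sub>v col W 0 = col (mat_adjoint W * W) 0"
    by (rule col_mult2[OF mat_adjoint_carrier[OF Wc] Wc, symmetric]) simp
  finally have col: "col A' 0 = e \<cdot>\<^sub>v unit_vec (Suc n) 0"
    using W(1) by (simp add: unitary_def)
  have col0: "A' $$ (i, 0) = (if i = 0 then e else 0)" if "i < Suc n" for i
    using arg_cong[OF col, of "\<lambda>w. w $ i"] A' that by auto
  have row0: "A' $$ (0, i) = (if i = 0 then e else 0)" if "i < Suc n" for i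
    using herm[OF _ that, of 0] herm[of 0 0] col0[OF that] col0[of 0] by auto
  \<comment> \<open>The eigenvalue is a diagonal entry of a Hermitian matrix, hence real.\<close>
  have e: "e = complex_of_real (Re e)"
    using herm[of 0 0] col0[of 0] by (simp add: complex_eq_iff)
  define B where "B = mat n n (\<lambda>(i, j). A' $$ (Suc i, Suc j))"
  have B: "B \<in> carrier_mat n n" by (simp add: B_def)
  have "mat_adjoint B = B"
  proof (rule eq_matI)
    fix i j assume "i < dim_row B" "j < dim_col B"
    then show "mat_adjoint B $$ (i, j) = B $$ (i, j)"
      using herm[of "Suc i" "Suc j"] by (simp add: B_def)
  qed (simp_all add: B_def)
  from Suc.IH[OF B this] obtain U d where U: "unitary n U" "B = fdiag n U d" by blast
  have Uc: "U \<in> carrier_mat n n" using U by (simp add: unitary_def)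
  \<comment> \<open>The direct sum of the 1 x 1 identity and the unitary that diagonalises the
    block; \<open>g\<close> puts the split-off eigenvalue in front of \<open>d\<close>.\<close>
  define V where "V = four_block_mat (1\<^sub>m 1) (0\<^sub>m 1 n) (0\<^sub>m n 1) U"
  define g where "g = case_nat (Re e) d"
  have V: "V \<in> carrier_mat (Suc n) (Suc n)"
    unfolding V_def using four_block_carrier_mat[OF one_carrier_mat[of 1] Uc] by simp
  have Vadj: "mat_adjoint V = four_block_mat (1\<^sub>m 1) (0\<^sub>m 1 n) (0\<^sub>m n 1) (mat_adjoint U)"
    using V Uc by (intro eq_matI) (auto simp: V_def)
  have "mat_adjoint V * V = four_block_mat (1\<^sub>m 1) (0\<^sub>m 1 n) (0\<^sub>m n 1) (1\<^sub>m n)"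
    unfolding Vadj unfolding V_def using U Uc
    by (subst mult_four_block_mat[of _ 1 1 _ n _ n _ _ 1 _ n]) (auto simp: unitary_def)
  then have "unitary (Suc n) V" using V by (simp add: unitary_def)
  moreover have "A' = fdiag (Suc n) V g"
  proof -
    let ?D = "mat_diag n (\<lambda>i. complex_of_real (d i))"
    have D: "mat_diag (Suc n) (\<lambda>i. complex_of_real (g i)) = four_block_mat (mat 1 1 (\<lambda>_. e)) (0\<^sub>m 1 n) (0\<^sub>m n 1) ?D"
      using e by (intro eq_matI) (auto simp: mat_diag_def g_def split: nat.split)
    have 1: "V * mat_diag (Suc n) (\<lambda>i. complex_of_real (g i))
      = four_block_mat (mat 1 1 (\<lambda>_. e)) (0\<^sub>m 1 n) (0\<^sub>m n 1) (U * ?D)"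
      unfolding D unfolding V_def using Uc
      by (subst mult_four_block_mat[of _ 1 1 _ n _ n _ _ 1 _ n]) (auto simp: mat_diag_def)
    have "fdiag (Suc n) V g = four_block_mat (mat 1 1 (\<lambda>_. e)) (0\<^sub>m 1 n) (0\<^sub>m n 1) B"
      unfolding fdiag_def 1 Vadj U(2) using Uc right_mult_zero_mat[of "U * ?D" n n 1]
      by (subst mult_four_block_mat[of _ 1 1 _ n _ n _ _ 1 _ n]) auto
    also have "\<dots> = A'"
      using A' col0 row0 by (intro eq_matI) (auto simp: B_def)
    finally show ?thesis by simp
  qed
  ultimately have "A = fdiag (Suc n) (W * V) g"
    using unitary_cancel[OF W(1) A] fdiag_conjugate[OF Wc V, of g] by (simp add: A'_def)
  with unitary_mult[OF W(1) \<open>unitary (Suc n) V\<close>] show ?case by blast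
qed

lemma psd_diagonalizable:
  assumes "psd n A"
  obtains U d where "unitary n U" "A = fdiag n U d" "\<And>i. d i \<ge> 0"
proof -
  obtain U d where U: "unitary n U" "A = fdiag n U d"
    using hermitian_diagonalizable psd_carrier psd_hermitian assms by metis
  \<comment> \<open>Eigenvalues at indices below \<open>n\<close> are already nonnegative; the
    maximum only changes the irrelevant ones, so that nonnegativity holds without an index
    bound.\<close>
  have "A = fdiag n U (\<lambda>i. max (d i) 0)"
    unfolding U(2) using psd_fdiag_nonneg[OF U(1) assms[unfolded U(2)]] by (intro fdiag_cong) (simp add: max.absorb1)
  then show ?thesis using that U(1) by auto
qed

text \<open>By uniqueness, the chosen power agrees with the one computed from any given
  diagonalisation.\<close>

lemma mat_powr_fdiag:
  assumes "unitary n U"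
  shows "mat_powr (fdiag n U d) a = fdiag n U (\<lambda>i. d i powr a)"
proof -
  have "is_mat_powr (fdiag n U d) a (fdiag n U (\<lambda>i. d i powr a))"
    using assms fdiag_carrier[of U n d] unfolding is_mat_powr_def unitary_def Let_def carrier_mat_def
    by (intro exI[of _ U] exI[of _ d]) (simp add: fdiag_def)
  then show ?thesis unfolding mat_powr_def using is_mat_powr_unique someI by metis
qed

lemma psd_mat_powr:
  assumes "psd n A"
  shows "psd n (mat_powr A a)"
proof -
  obtain U d where U: "unitary n U" "A = fdiag n U d" by (rule psd_diagonalizable[OF assms])
  show ?thesis unfolding U(2) mat_powr_fdiag[OF U(1)] by (intro fdiag_psd unitary_carrier U) simp
qed

lemma mat_powr_smult:
  assumes "psd n A" "c \<ge> 0"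
  shows "mat_powr (complex_of_real c \<cdot>\<^sub>m A) a = complex_of_real (c powr a) \<cdot>\<^sub>m mat_powr A a"
proof -
  obtain U d where U: "unitary n U" "A = fdiag n U d" "\<And>i. d i \<ge> 0"
    using psd_diagonalizable[OF assms(1)] by metis
  show ?thesis unfolding U(2) fdiag_smult[OF unitary_carrier[OF U(1)]] mat_powr_fdiag[OF U(1)]
    using U(3) assms(2) by (simp add: powr_mult)
qed

text \<open>With \<open>Z\<close> the square root of \<open>B\<close>, cyclicity turns the trace
  into that of the congruence Z A Z.\<close>

lemma psd_trace_mult:
  assumes "psd n A" "psd n B"
  shows "0 \<le> mat_trace (A * B)"
proof -
  obtain U d where U: "unitary n U" "B = fdiag n U d" "\<And>i. d i \<ge> 0"
    using psd_diagonalizable[OF assms(2)] by metis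
  have A: "A \<in> carrier_mat n n" by (rule psd_carrier[OF assms(1)])
  define Z where "Z = fdiag n U (\<lambda>i. sqrt (d i))"
  have Z: "Z \<in> carrier_mat n n" "mat_adjoint Z = Z"
    using unitary_carrier[OF U(1)] by (simp_all add: Z_def fdiag_adjoint)
  have "B = Z * Z" using U by (simp add: Z_def fdiag_mult)
  then have "mat_trace (A * B) = mat_trace ((A * Z) * Z)"
    using A Z by (simp add: square_assoc[where n=n])
  also have "\<dots> = mat_trace (mat_adjoint Z * A * Z)"
    using A Z mat_trace_comm[of "A * Z" n n Z] by (simp add: square_assoc[where n=n])
  finally show ?thesis using psd_trace[OF psd_congruence[OF assms(1) Z(1)]] by simp
qed

section \<open>Operator monotonicity of fractional powers\<close>

lemma mat_diag_mult_index:
  fixes A :: "complex mat"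
  assumes "A \<in> carrier_mat n n" "i < n"
  shows "(A * mat_diag n f) $$ (i, i) = A $$ (i, i) * f i"
    and "(mat_diag n f * A) $$ (i, i) = f i * A $$ (i, i)"
  using assms by (simp_all add: mat_diag_mult_left[of _ n n] mat_diag_mult_right[of _ n n])

text \<open>If \<open>c\<close> is the least eigenvalue, the matrix dominates c times the identity,
  and conjugation by a unitary preserves this bound. Every diagonal entry is thus at least
  \<open>c\<close>.\<close>

lemma fdiag_congruence_diag_pos:
  assumes V: "unitary n V" and E: "unitary n E" and g: "\<And>i. i < n \<Longrightarrow> g i > 0" and i: "i < n"
  shows "0 < Re ((mat_adjoint E * fdiag n V g * E) $$ (i, i))"
proof -
  define c where "c = Min (g ` {..<n})"
  have "c \<in> g ` {..<n}" unfolding c_def using i by (intro Min_in) auto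
  then have c: "c > 0" "\<And>j. j < n \<Longrightarrow> c \<le> g j"
    using g by (auto simp: c_def)
  have Ec: "E \<in> carrier_mat n n" and Vc: "V \<in> carrier_mat n n" using E V by (auto simp: unitary_def)
  have "psd n (fdiag n V g - complex_of_real c \<cdot>\<^sub>m 1\<^sub>m n)"
    unfolding fdiag_one[OF V, symmetric] fdiag_smult[OF Vc] fdiag_minus[OF Vc]
    using c by (intro fdiag_psd Vc) simp
  from psd_diag[OF psd_congruence[OF this Ec] i]
  have "0 \<le> (mat_adjoint E * (fdiag n V g - complex_of_real c \<cdot>\<^sub>m 1\<^sub>m n) * E) $$ (i, i)" .
  also have "mat_adjoint E * (fdiag n V g - complex_of_real c \<cdot>\<^sub>m 1\<^sub>m n) * E
     = mat_adjoint E * fdiag n V g * E - complex_of_real c \<cdot>\<^sub>m 1\<^sub>m n"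
  proof -
    have "mat_adjoint E * (fdiag n V g - complex_of_real c \<cdot>\<^sub>m 1\<^sub>m n) * E
      = mat_adjoint E * fdiag n V g * E - complex_of_real c \<cdot>\<^sub>m (mat_adjoint E * E)"
      using Ec Vc right_mult_one_mat[OF mat_adjoint_carrier[OF Ec]]
      by (simp add: square_distrib[where n=n])
    then show ?thesis using E by (simp add: unitary_def)
  qed
  finally show ?thesis
    using i Ec c(1) by (simp add: less_eq_complex_def)
qed

text \<open>With \<open>W = B\<^bsup>-m/2\<^esup> E\<close>, where \<open>E\<close> diagonalises \<open>B\<^bsup>-m/2\<^esup> A\<^bsup>m\<^esup> B\<^bsup>-m/2\<^esup>\<close>, the operators \<open>A\<^bsup>m\<^esup>\<close> and
  \<open>B\<^bsup>m\<^esup>\<close> are diagonalised simultaneously. Expanding \<open>(X - Y)\<^bsup>*\<^esup> (X - Y) \<ge> 0\<close> for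
  \<open>X = A\<^bsup>t/2\<^esup> W\<close> and \<open>Y = A\<^bsup>s/2\<^esup> B\<^bsup>(t-s)/2\<^esup> W\<close> bounds the generalised eigenvalues by one.\<close>

lemma loewner_heinz_midpoint:
  assumes U: "unitary n U" and V: "unitary n V" and b: "\<And>i. i < n \<Longrightarrow> b i > 0"
    and s: "psd n (fdiag n V (\<lambda>i. b i powr s) - fdiag n U (\<lambda>i. a i powr s))"
    and t: "psd n (fdiag n V (\<lambda>i. b i powr t) - fdiag n U (\<lambda>i. a i powr t))"
  shows "psd n (fdiag n V (\<lambda>i. b i powr ((s + t) / 2)) - fdiag n U (\<lambda>i. a i powr ((s + t) / 2)))"
proof -
  define m where "m = (s + t) / 2"
  define P where "P x = fdiag n U (\<lambda>i. a i powr x)" for x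
  define Q where "Q x = fdiag n V (\<lambda>i. b i powr x)" for x
  have Uc: "U \<in> carrier_mat n n" and Vc: "V \<in> carrier_mat n n" using U V by (auto simp: unitary_def)
  have c [simp]: "P x \<in> carrier_mat n n" "Q x \<in> carrier_mat n n" for x
    using Uc Vc by (simp_all add: P_def Q_def)
  have adj [simp]: "mat_adjoint (P x) = P x" "mat_adjoint (Q x) = Q x" for x
    using Uc Vc by (simp_all add: P_def Q_def fdiag_adjoint)
  have PP: "P x * P y = P (x + y)" and QQ: "Q x * Q y = Q (x + y)" for x y
    by (simp_all add: P_def Q_def fdiag_mult[OF U] fdiag_mult[OF V] powr_add)
  have PP': "P x * (P y * Z) = P (x + y) * Z" and QQ': "Q x * (Q y * Z) = Q (x + y) * Z"
    if "Z \<in> carrier_mat n n" for x y Z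
    using that by (simp_all flip: PP QQ add: square_assoc[where n=n])
  \<comment> \<open>Strict positivity of \<open>b\<close> matters here: since
    \<open>0 powr 0 = 0\<close>, the zeroth power is in general only the support projection.\<close>
  have Q0: "Q 0 = 1\<^sub>m n"
  proof -
    have "Q 0 = fdiag n V (\<lambda>i. 1)" unfolding Q_def using b by (intro fdiag_cong) force
    then show ?thesis by (simp add: fdiag_one[OF V])
  qed
  note assoc = square_assoc[where n=n]
  define C where "C = Q (- m / 2) * P m * Q (- m / 2)"
  have Cc: "C \<in> carrier_mat n n" by (simp add: C_def)
  have "mat_adjoint C = C"
    by (simp add: C_def mat_adjoint_mult[of _ n n _ n] assoc)
  then obtain E l where E: "unitary n E" and Cl: "C = fdiag n E l"
    using hermitian_diagonalizable[OF Cc] by blast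
  have Ec [simp]: "E \<in> carrier_mat n n" using E by (simp add: unitary_def)
  define D where "D = mat_diag n (\<lambda>i. complex_of_real (l i))"
  have Dc [simp]: "D \<in> carrier_mat n n" and Dadj [simp]: "mat_adjoint D = D" by (simp_all add: D_def)
  define W where "W = Q (- m / 2) * E"
  have Wc [simp]: "W \<in> carrier_mat n n" by (simp add: W_def)
  have CE: "C * E = E * D"
  proof -
    have "C * E = E * D * (mat_adjoint E * E)" by (simp add: Cl fdiag_def D_def assoc)
    then show ?thesis using E by (simp add: unitary_def right_mult_one_mat[of _ n n])
  qed
  \<comment> \<open>The generalised eigenvalue equation A^m W = B^m W D for the pair of midpoint
    powers.\<close>
  have PW: "P m * W = Q m * (W * D)"
  proof -
    have "P m * W = Q (m / 2) * (C * E)"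
      by (simp add: C_def W_def assoc QQ' Q0 left_mult_one_mat[of _ n n])
    also have "\<dots> = Q m * (W * D)"
      unfolding CE by (simp add: W_def assoc QQ')
    finally show ?thesis .
  qed
  \<comment> \<open>The extra factor B^((t-s)/2) is chosen so that \<open>Z\<close> carries B^s to
    the same matrix \<open>G\<close> to which \<open>W\<close> carries B^t. Both hypotheses are then
    compared with one \<open>G\<close>.\<close>
  define Z where "Z = Q ((t - s) / 2) * W"
  define X where "X = P (t / 2) * W"
  define Y where "Y = P (s / 2) * Z"
  define G where "G = mat_adjoint W * Q t * W"
  have cs [simp]: "Z \<in> carrier_mat n n" "X \<in> carrier_mat n n" "Y \<in> carrier_mat n n" "G \<in> carrier_mat n n"
    by (simp_all add: Z_def X_def Y_def G_def)
  have Wadj: "mat_adjoint W = mat_adjoint E * Q (- m / 2)"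
    by (simp add: W_def mat_adjoint_mult[of _ n n _ n])
  have adjs: "mat_adjoint X = mat_adjoint W * P (t / 2)" "mat_adjoint Y = mat_adjoint Z * P (s / 2)"
    "mat_adjoint Z = mat_adjoint W * Q ((t - s) / 2)"
    by (simp_all add: X_def Y_def Z_def mat_adjoint_mult[of _ n n _ n])
  have XX: "mat_adjoint X * X = mat_adjoint W * P t * W"
    unfolding adjs by (simp add: X_def assoc PP')
  have YY: "mat_adjoint Y * Y = mat_adjoint Z * P s * Z"
    unfolding adjs(2) by (simp add: Y_def assoc PP')
  have ZQZ: "mat_adjoint Z * Q s * Z = G"
    unfolding adjs(3) by (simp add: Z_def G_def assoc QQ' field_simps)
  \<comment> \<open>In the cross term the half powers of A combine to exponent (s+t)/2 = m, where
    the eigenvalue equation applies.\<close>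
  have YX: "mat_adjoint Y * X = G * D"
  proof -
    have "mat_adjoint Y * X = mat_adjoint Z * (P ((s + t) / 2) * W)"
      unfolding adjs(2) by (simp add: X_def assoc PP' add_divide_distrib)
    also have "\<dots> = mat_adjoint Z * (Q m * (W * D))" using PW by (simp add: m_def)
    also have "\<dots> = mat_adjoint W * (Q ((t - s) / 2 + m) * (W * D))"
      unfolding adjs(3) by (simp add: assoc QQ')
    also have "(t - s) / 2 + m = t" by (simp add: m_def field_simps)
    finally show ?thesis by (simp add: G_def assoc)
  qed
  have Gadj: "mat_adjoint G = G"
    by (simp add: G_def mat_adjoint_mult[of _ n n _ n] assoc)
  have XY: "mat_adjoint X * Y = D * G"
  proof -
    have "mat_adjoint X * Y = mat_adjoint (mat_adjoint Y * X)"
      by (simp add: mat_adjoint_mult[of _ n n _ n])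
    then show ?thesis by (simp add: YX mat_adjoint_mult[of _ n n _ n] Gadj)
  qed
  \<comment> \<open>Only diagonal entries are compared: both cross terms contribute l_i G_ii,
    although \<open>G\<close> and \<open>D\<close> may fail to commute. This gives 2 l_i G_ii \<le>
    (X'X)_ii + (Y'Y)_ii \<le> 2 G_ii, with primes for adjoints, and G_ii > 0 can be
    cancelled.\<close>
  have l: "l i \<le> 1" if i: "i < n" for i
  proof -
    have ix [simp]: "i < dim_row A" "i < dim_col A" if "A \<in> carrier_mat n n" for A :: "complex mat"
      using that i by auto
    have "psd n (mat_adjoint (X - Y) * (X - Y))" by (rule psd_gram[OF minus_carrier_mat[OF cs(3)]])
    also have "mat_adjoint (X - Y) * (X - Y)
        = (mat_adjoint X * X - mat_adjoint Y * X) - (mat_adjoint X * Y - mat_adjoint Y * Y)"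
      by (simp add: mat_adjoint_minus[of _ n n] square_distrib[where n=n] minus_carrier_mat)
    finally have "0 \<le> ((mat_adjoint X * X - G * D) - (D * G - mat_adjoint Y * Y)) $$ (i, i)"
      unfolding XY YX using i by (rule psd_diag)
    also have "\<dots> = (mat_adjoint X * X) $$ (i, i) - G $$ (i, i) * complex_of_real (l i)
        - (complex_of_real (l i) * G $$ (i, i) - (mat_adjoint Y * Y) $$ (i, i))"
      using mat_diag_mult_index[of G n i "\<lambda>i. complex_of_real (l i)"] i
      by (simp del: index_mult_mat(1) add: index_minus_mat minus_carrier_mat D_def[symmetric])
    finally have 1: "0 \<le> Re ((mat_adjoint X * X) $$ (i, i)) + Re ((mat_adjoint Y * Y) $$ (i, i))
        - 2 * l i * Re (G $$ (i, i))"
      by (simp add: less_eq_complex_def)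
    have "psd n (mat_adjoint W * (Q t - P t) * W)"
      by (rule psd_congruence[OF _ Wc]) (use t in \<open>simp add: P_def Q_def\<close>)
    also have "mat_adjoint W * (Q t - P t) * W = G - mat_adjoint X * X"
      by (simp add: XX G_def square_distrib[where n=n])
    finally have "0 \<le> (G - mat_adjoint X * X) $$ (i, i)" using i by (rule psd_diag)
    then have 2: "Re ((mat_adjoint X * X) $$ (i, i)) \<le> Re (G $$ (i, i))"
      by (simp del: index_mult_mat(1) add: less_eq_complex_def)
    have "psd n (mat_adjoint Z * (Q s - P s) * Z)"
      by (rule psd_congruence[OF _ cs(1)]) (use s in \<open>simp add: P_def Q_def\<close>)
    also have "mat_adjoint Z * (Q s - P s) * Z = G - mat_adjoint Y * Y"
      by (simp add: YY flip: ZQZ add: square_distrib[where n=n])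
    finally have "0 \<le> (G - mat_adjoint Y * Y) $$ (i, i)" using i by (rule psd_diag)
    then have 3: "Re ((mat_adjoint Y * Y) $$ (i, i)) \<le> Re (G $$ (i, i))"
      by (simp del: index_mult_mat(1) add: less_eq_complex_def)
    have "G = mat_adjoint E * Q (t - m) * E"
      unfolding G_def Wadj by (simp add: W_def assoc QQ')
    then have 4: "0 < Re (G $$ (i, i))"
      using fdiag_congruence_diag_pos[OF V E _ i, of "\<lambda>i. b i powr (t - m)"] b by (fastforce simp: Q_def)
    have "l i * Re (G $$ (i, i)) \<le> 1 * Re (G $$ (i, i))" using 1 2 3 by simp
    then show ?thesis using 4 by (simp only: mult_le_cancel_right_pos)
  qed
  \<comment> \<open>Eigenvalues at most one mean that \<open>C\<close> is below the identity;
    congruence with B^(m/2) turns this into A^m \<le> B^m.\<close>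
  have "psd n (1\<^sub>m n - C)"
    unfolding Cl fdiag_one[OF E, symmetric] fdiag_minus[OF Ec]
    using l by (intro fdiag_psd Ec) simp
  from psd_congruence[OF this, of "Q (m / 2)" n]
  have "psd n (Q (m / 2) * (1\<^sub>m n - C) * Q (m / 2))" by simp
  also have "Q (m / 2) * (1\<^sub>m n - C) * Q (m / 2) = Q (m / 2) * Q (m / 2) - Q (m / 2) * C * Q (m / 2)"
    using Cc right_mult_one_mat[of "Q (m / 2)" n n] by (simp add: square_distrib[where n=n])
  also have "Q (m / 2) * C * Q (m / 2) = P m"
    by (simp add: C_def assoc QQ QQ' Q0 right_mult_one_mat[of _ n n] left_mult_one_mat[of _ n n])
  also have "Q (m / 2) * Q (m / 2) = Q m" by (simp add: QQ)
  finally show ?thesis by (simp add: P_def Q_def m_def)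
qed

text \<open>A missing point would lie in a gap between a nearest element \<open>p\<close> on its
  left and \<open>q\<close> on its right. The midpoint of \<open>p\<close> and \<open>q\<close>
  belongs to \<open>S\<close> but falls inside this gap.\<close>

lemma closed_midpoint_convex:
  fixes S :: "real set"
  assumes S: "closed S" and mid: "\<And>s t. s \<in> S \<Longrightarrow> t \<in> S \<Longrightarrow> (s + t) / 2 \<in> S"
    and ab: "a \<in> S" "b \<in> S" and s: "a \<le> s" "s \<le> b"
  shows "s \<in> S"
proof (rule ccontr)
  assume ns: "s \<notin> S"
  obtain p where p: "p \<in> {a..s} \<inter> S" "\<And>x. x \<in> {a..s} \<inter> S \<Longrightarrow> x \<le> p"
    using compact_attains_sup[of "{a..s} \<inter> S"] S ab s by (metis IntI atLeastAtMost_iff compact_Icc compact_Int_closed empty_iff order_refl)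
  obtain q where q: "q \<in> {s..b} \<inter> S" "\<And>x. x \<in> {s..b} \<inter> S \<Longrightarrow> q \<le> x"
    using compact_attains_inf[of "{s..b} \<inter> S"] S ab s by (metis IntI atLeastAtMost_iff compact_Icc compact_Int_closed empty_iff order_refl)
  have "p < s" "s < q" using p q ns by (auto simp: less_le)
  moreover have "(p + q) / 2 \<in> S" using mid p q by blast
  ultimately show False
    using p(2)[of "(p + q) / 2"] q(2)[of "(p + q) / 2"] p(1) q(1) by (cases "(p + q) / 2 \<le> s") auto
qed

text \<open>The exponents for which the inequality holds form a closed set containing 0 and 1 and
  stable under midpoints, hence all of [0,1].\<close>

lemma loewner_heinz:
  assumes U: "unitary n U" and V: "unitary n V" and a: "\<And>i. a i \<ge> 0" and b: "\<And>i. b i > 0"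
    and le: "psd n (fdiag n V b - fdiag n U a)" and s: "0 \<le> s" "s \<le> 1"
  shows "psd n (fdiag n V (\<lambda>i. b i powr s) - fdiag n U (\<lambda>i. a i powr s))"
proof -
  have Uc: "U \<in> carrier_mat n n" and Vc: "V \<in> carrier_mat n n" using U V by (auto simp: unitary_def)
  define F where "F s = fdiag n V (\<lambda>i. b i powr s) - fdiag n U (\<lambda>i. a i powr s)" for s
  have Fc: "F s \<in> carrier_mat n n" for s using Uc Vc by (simp add: F_def minus_carrier_mat)
  define q where "q v s = (F s *\<^sub>v v) \<bullet>c v" for v s
  have cont: "continuous_on UNIV (q v)" if v: "v \<in> carrier_vec n" for v
  proof -
    have "q v = (\<lambda>s. (fdiag n V (\<lambda>i. b i powr s) *\<^sub>v v) \<bullet>c v - (fdiag n U (\<lambda>i. a i powr s) *\<^sub>v v) \<bullet>c v)"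
      using v Uc Vc unfolding q_def F_def
      by (simp add: minus_mult_distrib_mat_vec[of _ n n] minus_scalar_prod_distrib[of _ n] mult_mat_vec_carrier[of _ n n])
    \<comment> \<open>A zero eigenvalue gives the constant function 0, so there is no jump at
      exponent 0.\<close>
    moreover have "continuous_on UNIV (\<lambda>s. c powr s)" if "c \<ge> 0" for c :: real
      using that by (cases "c = 0") (auto intro!: continuous_intros)
    ultimately show ?thesis
      unfolding fdiag_inner_prod[OF Uc v] fdiag_inner_prod[OF Vc v]
      using a less_imp_le[OF b]
      by (auto intro!: continuous_on_diff continuous_on_sum continuous_on_mult continuous_on_of_real continuous_on_const)
  qed
  have "{s. psd n (F s)} = (\<Inter>v \<in> carrier_vec n. {s. 0 \<le> Re (q v s)} \<inter> {s. Im (q v s) = 0})"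
    using Fc by (auto simp: psd_def q_def less_eq_complex_def)
  moreover have "closed ({s. 0 \<le> Re (q v s)} \<inter> {s. Im (q v s) = 0})" if "v \<in> carrier_vec n" for v
    using cont[OF that] by (intro closed_Int closed_Collect_le closed_Collect_eq continuous_intros) auto
  ultimately have "closed {s. psd n (F s)}" by auto
  moreover have "psd n (F 0)"
  proof -
    have "fdiag n V (\<lambda>i. b i powr 0) = 1\<^sub>m n"
      using b by (simp add: fdiag_one[OF V] less_imp_neq[symmetric])
    \<comment> \<open>The zeroth power of the larger matrix is the identity, that of the smaller one
      the projection onto its support; \<open>F 0\<close> is the complementary projection.\<close>
    then have "F 0 = fdiag n U (\<lambda>i. 1 - a i powr 0)"
      by (simp only: F_def fdiag_one[OF U, symmetric] fdiag_minus[OF Uc])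
    then show ?thesis by (simp only:) (intro fdiag_psd Uc, simp)
  qed
  moreover have "psd n (F 1)"
    using le a less_imp_le[OF b] by (simp add: F_def)
  moreover have "psd n (F ((s + t) / 2))" if "psd n (F s)" "psd n (F t)" for s t
    using loewner_heinz_midpoint[OF U V b] that by (simp add: F_def)
  ultimately have "s \<in> {s. psd n (F s)}"
    using closed_midpoint_convex[of "{s. psd n (F s)}" 0 1 s] s by blast
  then show ?thesis by (simp add: F_def)
qed

section \<open>The quantum Chernoff trace inequality\<close>

text \<open>Ozawa's argument: \<open>K = B + (A - B)\<^sub>+\<close> dominates both \<open>A\<close> and \<open>B\<close>, and so do its fractional
  powers. The perturbation \<open>\<epsilon>\<close> makes \<open>K\<close> invertible.\<close>

theorem chernoff_trace_inequality:
  assumes A: "psd n A" and B: "psd n B" and s: "0 < s" "s < 1"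
  obtains T where "is_test n T"
    "Re (mat_trace ((1\<^sub>m n - T) * A)) + Re (mat_trace (T * B))
      \<le> Re (mat_trace (mat_powr A s * mat_powr B (1 - s)))"
proof -
  obtain U a where U: "unitary n U" "A = fdiag n U a" and a: "\<And>i. a i \<ge> 0"
    using psd_diagonalizable[OF A] by metis
  obtain V b where V: "unitary n V" "B = fdiag n V b" and b: "\<And>i. b i \<ge> 0"
    using psd_diagonalizable[OF B] by metis
  note Ac = psd_carrier[OF A] and Bc = psd_carrier[OF B]
  have "mat_adjoint (A - B) = A - B"
    using mat_adjoint_minus[OF Ac Bc] psd_hermitian A B by simp
  then obtain E h where E: "unitary n E" and h: "A - B = fdiag n E h"
    using hermitian_diagonalizable[of "A - B" n] Bc minus_carrier_mat by blast
  have Ec [simp]: "E \<in> carrier_mat n n" using E by (simp add: unitary_def)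
  have Uc [simp]: "U \<in> carrier_mat n n" and Vc [simp]: "V \<in> carrier_mat n n"
    using U V by (simp_all add: unitary_def)
  \<comment> \<open>\<open>T\<close> projects onto the positive eigenspaces of A - B, and
    \<open>H\<close> is the positive part of A - B.\<close>
  define T where "T = fdiag n E (\<lambda>i. if h i > 0 then 1 else 0)"
  define H where "H = fdiag n E (\<lambda>i. max (h i) 0)"
  have Tc [simp]: "T \<in> carrier_mat n n" and Hc [simp]: "H \<in> carrier_mat n n"
    by (simp_all add: T_def H_def)
  have Hpsd: "psd n H" unfolding H_def by (intro fdiag_psd) auto
  have test: "is_test n T"
    unfolding is_test_def T_def fdiag_one[OF E, symmetric] fdiag_minus[OF Ec]
    by (intro conjI fdiag_psd Ec) auto
  have "T * (A - B) = H"
    unfolding h T_def H_def fdiag_mult[OF E] by (intro fdiag_cong) auto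
  then have TAB: "mat_trace (T * A) - mat_trace (T * B) = mat_trace H"
    using Ac Bc by (simp add: square_distrib[where n=n] flip: mat_trace_minus[of _ n])
  have "mat_trace ((1\<^sub>m n - T) * A) = mat_trace A - mat_trace (T * A)"
    using Ac by (simp add: square_distrib[where n=n] left_mult_one_mat[of _ n n] mat_trace_minus[of _ n])
  then have lhs: "Re (mat_trace ((1\<^sub>m n - T) * A)) + Re (mat_trace (T * B)) = Re (mat_trace A) - Re (mat_trace H)"
    using arg_cong[OF TAB, of Re] by simp
  define As where "As x = fdiag n U (\<lambda>i. a i powr x)" for x
  define Bs where "Bs x = fdiag n V (\<lambda>i. b i powr x)" for x
  have pc [simp]: "As x \<in> carrier_mat n n" "Bs x \<in> carrier_mat n n" for x
    by (simp_all add: As_def Bs_def)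
  have pp: "psd n (As x)" "psd n (Bs x)" for x
    unfolding As_def Bs_def by (auto intro!: fdiag_psd)
  have AA: "As s * As (1 - s) = A" and BB: "Bs s * Bs (1 - s) = B"
    using a b by (simp_all add: As_def Bs_def U V fdiag_mult flip: powr_add)
  \<comment> \<open>By \<open>lhs\<close> it suffices to bound Tr A - Tr A^s B^(1-s) by Tr H. With
    \<open>K\<close> the matrix B + H + \<epsilon>, the chain below bounds it by Tr K - Tr B, which
    exceeds Tr H by exactly n \<epsilon>.\<close>
  have bound: "Re (mat_trace A) - Re (mat_trace (As s * Bs (1 - s))) \<le> Re (mat_trace H) + real n * \<epsilon>"
    if \<epsilon>: "\<epsilon> > 0" for \<epsilon>
  proof -
    have "psd n (B + H)" by (rule psd_add[OF B Hpsd])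
    then obtain W k where W: "unitary n W" "B + H = fdiag n W k" and k: "\<And>i. k i \<ge> 0"
      using psd_diagonalizable by metis
    have Wc [simp]: "W \<in> carrier_mat n n" using W by (simp add: unitary_def)
    define Ks where "Ks x = fdiag n W (\<lambda>i. (k i + \<epsilon>) powr x)" for x
    have kc [simp]: "Ks x \<in> carrier_mat n n" for x by (simp add: Ks_def)
    have k0: "k i + \<epsilon> > 0" for i using k[of i] \<epsilon> by simp
    define K where "K = fdiag n W (\<lambda>i. k i + \<epsilon>)"
    have Kc [simp]: "K \<in> carrier_mat n n" by (simp add: K_def)
    have K: "K = (B + H) + complex_of_real \<epsilon> \<cdot>\<^sub>m 1\<^sub>m n"
      unfolding W(2) fdiag_one[OF W(1), symmetric] fdiag_smult[OF Wc] fdiag_add[OF Wc] by (simp add: K_def)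
    have e1: "complex_of_real \<epsilon> \<cdot>\<^sub>m 1\<^sub>m n = fdiag n E (\<lambda>i. \<epsilon>)"
      unfolding fdiag_one[OF E, symmetric] fdiag_smult[OF Ec] by simp
    have "K - B = H + complex_of_real \<epsilon> \<cdot>\<^sub>m 1\<^sub>m n"
      unfolding K using Bc Hc by (intro eq_matI) auto
    also have "\<dots> = fdiag n E (\<lambda>i. max (h i) 0 + \<epsilon>)"
      unfolding e1 H_def fdiag_add[OF Ec] by simp
    also have "psd n \<dots>" using \<epsilon> by (intro fdiag_psd) auto
    finally have KB: "psd n (K - B)" .
    have "K - A = (H + complex_of_real \<epsilon> \<cdot>\<^sub>m 1\<^sub>m n) - (A - B)"
      unfolding K using Ac Bc Hc by (intro eq_matI) auto
    \<comment> \<open>The eigenvalues are \<epsilon> plus the negative part of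
      \<open>h\<close>.\<close>
    also have "\<dots> = fdiag n E (\<lambda>i. max (h i) 0 + \<epsilon> - h i)"
      unfolding h e1 H_def fdiag_add[OF Ec] fdiag_minus[OF Ec] by simp
    also have "psd n \<dots>" using \<epsilon> by (intro fdiag_psd) auto
    finally have KA: "psd n (K - A)" .
    have monoA: "psd n (Ks x - As x)" and monoB: "psd n (Ks x - Bs x)" if "0 \<le> x" "x \<le> 1" for x
      unfolding Ks_def As_def Bs_def using that k0 a b KA KB
      by (auto intro!: loewner_heinz U V W simp: K_def U(2) V(2))
    have s': "0 \<le> s" "s \<le> 1" "0 \<le> 1 - s" "1 - s \<le> 1" using s by auto
    have KK: "Ks s * Ks (1 - s) = K"
      using less_imp_le[OF k0] by (simp add: Ks_def K_def fdiag_mult[OF W(1)] flip: powr_add)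
    \<comment> \<open>Three replacements, each by positivity of the trace of a product: A^(1-s) by
      K^(1-s) next to A^s, then A^s by K^s next to K^(1-s) - B^(1-s), and finally K^s by B^s next to
      B^(1-s).\<close>
    have "0 \<le> mat_trace (As s * (Ks (1 - s) - As (1 - s)))"
      by (rule psd_trace_mult[OF pp(1) monoA]) (use s' in auto)
    also have "As s * (Ks (1 - s) - As (1 - s)) = As s * Ks (1 - s) - A"
      by (simp add: square_distrib[where n=n] AA)
    finally have 1: "Re (mat_trace A) \<le> Re (mat_trace (As s * Ks (1 - s)))"
      using Ac by (simp add: mat_trace_minus[of _ n] less_eq_complex_def)
    have "0 \<le> mat_trace ((Ks s - As s) * (Ks (1 - s) - Bs (1 - s)))"
      by (rule psd_trace_mult[OF monoA monoB]) (use s' in auto)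
    also have "(Ks s - As s) * (Ks (1 - s) - Bs (1 - s))
        = (K - As s * Ks (1 - s)) - (Ks s * Bs (1 - s) - As s * Bs (1 - s))"
      by (simp add: square_distrib[where n=n] minus_carrier_mat KK)
    finally have 2: "Re (mat_trace (As s * Ks (1 - s))) - Re (mat_trace (As s * Bs (1 - s)))
        \<le> Re (mat_trace K) - Re (mat_trace (Ks s * Bs (1 - s)))"
      by (simp add: mat_trace_minus[of _ n] minus_carrier_mat less_eq_complex_def)
    have "0 \<le> mat_trace ((Ks s - Bs s) * Bs (1 - s))"
      by (rule psd_trace_mult[OF monoB pp(2)]) (use s' in auto)
    also have "(Ks s - Bs s) * Bs (1 - s) = Ks s * Bs (1 - s) - B"
      by (simp add: square_distrib[where n=n] BB)
    finally have 3: "Re (mat_trace B) \<le> Re (mat_trace (Ks s * Bs (1 - s)))"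
      using Bc by (simp add: mat_trace_minus[of _ n] less_eq_complex_def)
    have "mat_trace (1\<^sub>m n) = of_nat n" by (simp add: mat_trace_def)
    then have "Re (mat_trace K) = Re (mat_trace B) + Re (mat_trace H) + real n * \<epsilon>"
      unfolding K using Bc by (simp add: mat_trace_add[of _ n] mat_trace_smult[of _ n])
    with 1 2 3 show ?thesis by simp
  qed
  have "Re (mat_trace A) - Re (mat_trace (As s * Bs (1 - s))) \<le> Re (mat_trace H)"
  proof (rule field_le_epsilon)
    fix e :: real assume e: "e > 0"
    \<comment> \<open>Dividing by n + 1 instead of n also covers dimension zero.\<close>
    have "real n * (e / (real n + 1)) \<le> e" using e by (simp add: field_simps)
    then show "Re (mat_trace A) - Re (mat_trace (As s * Bs (1 - s))) \<le> Re (mat_trace H) + e"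
      using bound[of "e / (real n + 1)"] e by simp
  qed
  then show ?thesis
    using that[OF test] lhs by (simp add: As_def Bs_def U V mat_powr_fdiag)
qed

section \<open>Tensor products\<close>

text \<open>Quotient and remainder by \<open>m\<close> identify the indices below n m with pairs,
  which is the index convention of \<open>tensor_mat\<close>.\<close>

lemma sum_div_mod:
  fixes f :: "nat \<Rightarrow> nat \<Rightarrow> 'a :: comm_monoid_add"
  shows "(\<Sum>k<n * m. f (k div m) (k mod m)) = (\<Sum>i<n. \<Sum>j<m. f i j)"
proof (cases "m = 0")
  case False
  have "(\<Sum>k<n * m. f (k div m) (k mod m)) = (\<Sum>(i, j)\<in>{..<n} \<times> {..<m}. f i j)"
  proof (rule sum.reindex_bij_witness[of _ "\<lambda>(i, j). i * m + j" "\<lambda>k. (k div m, k mod m)"])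
    fix k assume "k \<in> {..<n * m}"
    then show "(k div m, k mod m) \<in> {..<n} \<times> {..<m}"
      using False by (auto simp: less_mult_imp_div_less)
  next
    fix p assume "p \<in> {..<n} \<times> {..<m}"
    then obtain i j where p: "p = (i, j)" "i < n" "j < m" by auto
    have "i * m + j < (i + 1) * m" using p by simp
    also have "\<dots> \<le> n * m" using p by (intro mult_le_mono1) simp
    finally show "(case p of (i, j) \<Rightarrow> i * m + j) \<in> {..<n * m}" using p by simp
  qed auto
  then show ?thesis by (simp add: sum.cartesian_product)
qed simp

lemma div_mod_less:
  fixes i n m :: nat
  assumes "i < n * m"
  shows "i div m < n" "i mod m < m"
  using assms by (auto simp: less_mult_imp_div_less intro!: mod_less_divisor gr0I)

lemma div_mod_eq_iff: "(i :: nat) = j \<longleftrightarrow> i div m = j div m \<and> i mod m = j mod m"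
  by (metis div_mult_mod_eq)

lemma tensor_mat_carrier [simp]:
  "A \<in> carrier_mat n n \<Longrightarrow> B \<in> carrier_mat m m \<Longrightarrow> tensor_mat A B \<in> carrier_mat (n * m) (n * m)"
  unfolding tensor_mat_def by (auto intro!: mat_carrier)

lemma tensor_mat_index:
  assumes "A \<in> carrier_mat n n" "B \<in> carrier_mat m m" "i < n * m" "j < n * m"
  shows "tensor_mat A B $$ (i, j) = A $$ (i div m, j div m) * B $$ (i mod m, j mod m)"
  using assms by (simp add: tensor_mat_def)

lemma tensor_mat_mult:
  assumes "A \<in> carrier_mat n n" "B \<in> carrier_mat m m" "C \<in> carrier_mat n n" "D \<in> carrier_mat m m"
  shows "tensor_mat A B * tensor_mat C D = tensor_mat (A * C) (B * D)"
proof (rule eq_matI)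
  have c: "tensor_mat A B \<in> carrier_mat (n * m) (n * m)" "tensor_mat C D \<in> carrier_mat (n * m) (n * m)"
    "tensor_mat (A * C) (B * D) \<in> carrier_mat (n * m) (n * m)" using assms by simp_all
  show "dim_row (tensor_mat A B * tensor_mat C D) = dim_row (tensor_mat (A * C) (B * D))"
    "dim_col (tensor_mat A B * tensor_mat C D) = dim_col (tensor_mat (A * C) (B * D))"
    using c by auto
  fix i j assume "i < dim_row (tensor_mat (A * C) (B * D))" "j < dim_col (tensor_mat (A * C) (B * D))"
  then have ij: "i < n * m" "j < n * m" using c by auto
  note dm = div_mod_less[OF ij(1)] div_mod_less[OF ij(2)]
  have "(tensor_mat A B * tensor_mat C D) $$ (i, j) = (\<Sum>k<n * m. tensor_mat A B $$ (i, k) * tensor_mat C D $$ (k, j))"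
    using c ij by (auto simp: scalar_prod_def lessThan_atLeast0)
  also have "\<dots> = (\<Sum>k<n * m. (A $$ (i div m, k div m) * B $$ (i mod m, k mod m))
      * (C $$ (k div m, j div m) * D $$ (k mod m, j mod m)))"
    using ij by (intro sum.cong refl) (simp add: tensor_mat_index[OF assms(1,2)] tensor_mat_index[OF assms(3,4)])
  also have "\<dots> = (\<Sum>k<n. \<Sum>l<m. (A $$ (i div m, k) * B $$ (i mod m, l)) * (C $$ (k, j div m) * D $$ (l, j mod m)))"
    by (rule sum_div_mod)
  also have "\<dots> = (\<Sum>k<n. A $$ (i div m, k) * C $$ (k, j div m)) * (\<Sum>l<m. B $$ (i mod m, l) * D $$ (l, j mod m))"
    by (simp add: sum_product mult_ac)
  also have "\<dots> = (A * C) $$ (i div m, j div m) * (B * D) $$ (i mod m, j mod m)"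
    using assms dm by (auto simp: scalar_prod_def lessThan_atLeast0)
  finally show "(tensor_mat A B * tensor_mat C D) $$ (i, j) = tensor_mat (A * C) (B * D) $$ (i, j)"
    using tensor_mat_index[of "A * C" n "B * D" m i j] assms ij by simp
qed

lemma tensor_mat_adjoint:
  assumes "A \<in> carrier_mat n n" "B \<in> carrier_mat m m"
  shows "mat_adjoint (tensor_mat A B) = tensor_mat (mat_adjoint A) (mat_adjoint B)"
proof (rule eq_matI)
  have c: "tensor_mat A B \<in> carrier_mat (n * m) (n * m)"
    "tensor_mat (mat_adjoint A) (mat_adjoint B) \<in> carrier_mat (n * m) (n * m)" using assms by simp_all
  show "dim_row (mat_adjoint (tensor_mat A B)) = dim_row (tensor_mat (mat_adjoint A) (mat_adjoint B))"
    "dim_col (mat_adjoint (tensor_mat A B)) = dim_col (tensor_mat (mat_adjoint A) (mat_adjoint B))"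
    using c by auto
  fix i j assume "i < dim_row (tensor_mat (mat_adjoint A) (mat_adjoint B))"
    "j < dim_col (tensor_mat (mat_adjoint A) (mat_adjoint B))"
  then have ij: "i < n * m" "j < n * m" using c by auto
  have "mat_adjoint (tensor_mat A B) $$ (i, j) = cnj (tensor_mat A B $$ (j, i))"
    using c(1) ij by (subst mat_adjoint_index) auto
  then show "mat_adjoint (tensor_mat A B) $$ (i, j) = tensor_mat (mat_adjoint A) (mat_adjoint B) $$ (i, j)"
    using assms ij div_mod_less[OF ij(1)] div_mod_less[OF ij(2)]
    by (simp add: tensor_mat_index[of _ n _ m])
qed

lemma tensor_mat_diag:
  "tensor_mat (mat_diag n f) (mat_diag m g) = mat_diag (n * m) (\<lambda>i. f (i div m) * g (i mod m))"
proof (rule eq_matI)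
  fix i j assume "i < dim_row (mat_diag (n * m) (\<lambda>i. f (i div m) * g (i mod m)))"
    "j < dim_col (mat_diag (n * m) (\<lambda>i. f (i div m) * g (i mod m)))"
  then have ij: "i < n * m" "j < n * m" by (auto simp: mat_diag_def)
  show "tensor_mat (mat_diag n f) (mat_diag m g) $$ (i, j) = mat_diag (n * m) (\<lambda>i. f (i div m) * g (i mod m)) $$ (i, j)"
    unfolding tensor_mat_index[OF mat_diag_dim mat_diag_dim ij] unfolding mat_diag_def
    using ij div_mod_less[OF ij(1)] div_mod_less[OF ij(2)] div_mod_eq_iff[of i j m] by auto
qed (simp_all add: tensor_mat_def mat_diag_def)

lemma tensor_mat_one: "tensor_mat (1\<^sub>m n) (1\<^sub>m m) = 1\<^sub>m (n * m)"
  using tensor_mat_diag[of n "\<lambda>_. 1" m "\<lambda>_. 1"] by simp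

lemma mat_trace_tensor:
  assumes "A \<in> carrier_mat n n" "B \<in> carrier_mat m m"
  shows "mat_trace (tensor_mat A B) = mat_trace A * mat_trace B"
proof -
  have "mat_trace (tensor_mat A B) = (\<Sum>k<n * m. A $$ (k div m, k div m) * B $$ (k mod m, k mod m))"
    using tensor_mat_carrier[OF assms] by (auto simp: mat_trace_def tensor_mat_index[OF assms])
  also have "\<dots> = (\<Sum>k<n. \<Sum>l<m. A $$ (k, k) * B $$ (l, l))" by (rule sum_div_mod)
  also have "\<dots> = mat_trace A * mat_trace B"
    using assms by (simp add: mat_trace_def sum_product)
  finally show ?thesis .
qed

lemma unitary_tensor:
  assumes "unitary n U" "unitary m V"
  shows "unitary (n * m) (tensor_mat U V)"
  using assms by (simp add: unitary_def tensor_mat_adjoint[of _ n _ m] tensor_mat_mult[of _ n _ m] tensor_mat_one)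

lemma tensor_fdiag:
  assumes "U \<in> carrier_mat n n" "V \<in> carrier_mat m m"
  shows "tensor_mat (fdiag n U g) (fdiag m V h)
    = fdiag (n * m) (tensor_mat U V) (\<lambda>i. g (i div m) * h (i mod m))"
  unfolding fdiag_def
  using assms by (simp add: tensor_mat_mult[of _ n _ m, symmetric] tensor_mat_adjoint[of _ n _ m] tensor_mat_diag)

text \<open>The product eigenbasis diagonalises the tensor product, with the products of the
  eigenvalues. Real powers are multiplicative on nonnegative numbers.\<close>

lemma psd_tensor:
  assumes "psd n A" "psd m B"
  shows "psd (n * m) (tensor_mat A B)"
    and "mat_powr (tensor_mat A B) x = tensor_mat (mat_powr A x) (mat_powr B x)"
proof -
  obtain U a where U: "unitary n U" "A = fdiag n U a" "\<And>i. a i \<ge> 0"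
    using psd_diagonalizable[OF assms(1)] by metis
  obtain V b where V: "unitary m V" "B = fdiag m V b" "\<And>i. b i \<ge> 0"
    using psd_diagonalizable[OF assms(2)] by metis
  note c = unitary_carrier[OF U(1)] unitary_carrier[OF V(1)]
  show "psd (n * m) (tensor_mat A B)"
    unfolding U(2) V(2) tensor_fdiag[OF c]
    using U(3) V(3) c by (intro fdiag_psd) auto
  show "mat_powr (tensor_mat A B) x = tensor_mat (mat_powr A x) (mat_powr B x)"
    unfolding U(2) V(2) tensor_fdiag[OF c] mat_powr_fdiag[OF U(1)] mat_powr_fdiag[OF V(1)]
      mat_powr_fdiag[OF unitary_tensor[OF U(1) V(1)]]
    using U(3) V(3) by (simp add: powr_mult)
qed

lemma tensor_power_carrier:
  "A \<in> carrier_mat d d \<Longrightarrow> tensor_list (replicate n A) \<in> carrier_mat (d ^ n) (d ^ n)"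
  by (induction n) auto

lemma psd_tensor_power:
  assumes "psd d A"
  shows "psd (d ^ n) (tensor_list (replicate n A))"
  using assms by (induction n) (auto simp: psd_one intro: psd_tensor)

lemma mat_powr_tensor_power:
  assumes "psd d A"
  shows "mat_powr (tensor_list (replicate n A)) x = tensor_list (replicate n (mat_powr A x))"
proof (induction n)
  case 0
  have 1: "unitary 1 (1\<^sub>m 1)" by (simp add: unitary_def)
  \<comment> \<open>The empty tensor product is the 1 x 1 identity, diagonalised with eigenvalue
    1.\<close>
  show ?case using mat_powr_fdiag[OF 1, of "\<lambda>_. 1" x] by (simp only: fdiag_one[OF 1] powr_one_eq_one replicate_0 tensor_list.simps)
next
  case (Suc n)
  then show ?case using psd_tensor(2)[OF assms psd_tensor_power[OF assms, of n], of x] by simp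
qed

lemma tensor_power_mult:
  assumes "A \<in> carrier_mat d d" "B \<in> carrier_mat d d"
  shows "tensor_list (replicate n A) * tensor_list (replicate n B) = tensor_list (replicate n (A * B))"
proof (induction n)
  case (Suc n)
  then show ?case
    using tensor_mat_mult[OF assms(1) tensor_power_carrier[OF assms(1), of n] assms(2) tensor_power_carrier[OF assms(2), of n]]
    by simp
qed simp

lemma mat_trace_tensor_power:
  assumes "A \<in> carrier_mat d d"
  shows "mat_trace (tensor_list (replicate n A)) = mat_trace A ^ n"
proof (induction n)
  case 0
  show ?case by (simp add: mat_trace_def)
next
  case (Suc n)
  then show ?case using mat_trace_tensor[OF assms tensor_power_carrier[OF assms, of n]] by simp
qed

section \<open>Error exponents of product strategies\<close>

text \<open>Complete positivity with a one-dimensional ancilla: there is a single block, namely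
  \<rho> itself.\<close>

lemma CPTP_psd:
  assumes N: "N \<in> CPTP dA dB" and \<rho>: "psd dA \<rho>"
  shows "psd dB (N \<rho>)"
proof -
  have c: "\<rho> \<in> carrier_mat dA dA" by (rule psd_carrier[OF \<rho>])
  then have Nc: "N \<rho> \<in> carrier_mat dB dB" using N by (simp add: CPTP_def)
  have "mat_block dA \<rho> 0 0 = \<rho>" using c by (intro eq_matI) (auto simp: mat_block_def)
  then have "id_tensor 1 dA dB N \<rho> = N \<rho>"
    using Nc by (intro eq_matI) (auto simp: id_tensor_def)
  moreover have "psd (1 * dB) (id_tensor 1 dA dB N \<rho>)"
    using N \<rho> unfolding CPTP_def by (metis (mono_tags, lifting) mem_Collect_eq mult_1)
  ultimately show ?thesis by simp
qed

text \<open>The trace inequality for the n-fold power of \<rho> and c times that of \<sigma> bounds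
  (Type-I error) + c (Type-II error) by c^(1-\<alpha>) t^n, as powers and traces factor over tensor
  powers. Both errors are nonnegative, so each summand obeys the bound.\<close>

lemma hoeffding_test:
  assumes \<rho>: "psd d \<rho>" and \<sigma>: "psd d \<sigma>" and \<alpha>: "0 < \<alpha>" "\<alpha> < 1" and c: "c > 0"
  defines "t \<equiv> Re (mat_trace (mat_powr \<rho> \<alpha> * mat_powr \<sigma> (1 - \<alpha>)))"
  shows "\<exists>T. is_test (d ^ n) T
    \<and> Re (mat_trace ((1\<^sub>m (d ^ n) - T) * tensor_list (replicate n \<rho>))) \<le> c powr (1 - \<alpha>) * t ^ n
    \<and> Re (mat_trace (T * tensor_list (replicate n \<sigma>))) \<le> c powr - \<alpha> * t ^ n"
proof -
  define A where "A = tensor_list (replicate n \<rho>)"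
  define B where "B = tensor_list (replicate n \<sigma>)"
  have A: "psd (d ^ n) A" and B: "psd (d ^ n) B"
    unfolding A_def B_def by (intro psd_tensor_power \<rho> \<sigma>)+
  define P where "P = mat_powr \<rho> \<alpha>"
  define Q where "Q = mat_powr \<sigma> (1 - \<alpha>)"
  have P: "psd d P" and Q: "psd d Q" unfolding P_def Q_def by (intro psd_mat_powr \<rho> \<sigma>)+
  note Pc = psd_carrier[OF P] and Qc = psd_carrier[OF Q]
  obtain T where T: "is_test (d ^ n) T" and le:
    "Re (mat_trace ((1\<^sub>m (d ^ n) - T) * A)) + Re (mat_trace (T * (complex_of_real c \<cdot>\<^sub>m B)))
      \<le> Re (mat_trace (mat_powr A \<alpha> * mat_powr (complex_of_real c \<cdot>\<^sub>m B) (1 - \<alpha>)))"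
    using chernoff_trace_inequality[OF A psd_smult[OF B less_imp_le[OF c]] \<alpha>] by blast
  have Tp: "psd (d ^ n) T" "psd (d ^ n) (1\<^sub>m (d ^ n) - T)" using T by (auto simp: is_test_def)
  have Tc: "T \<in> carrier_mat (d ^ n) (d ^ n)" by (rule psd_carrier[OF Tp(1)])
  have "0 \<le> mat_trace (P * Q)" by (rule psd_trace_mult[OF P Q])
  then have tPQ: "mat_trace (P * Q) = complex_of_real t"
    by (simp add: t_def P_def Q_def less_eq_complex_def complex_eq_iff)
  have "mat_powr A \<alpha> * mat_powr (complex_of_real c \<cdot>\<^sub>m B) (1 - \<alpha>)
    = complex_of_real (c powr (1 - \<alpha>)) \<cdot>\<^sub>m (mat_powr A \<alpha> * mat_powr B (1 - \<alpha>))"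
    unfolding mat_powr_smult[OF B less_imp_le[OF c]]
    by (intro mult_smult_distrib[of _ "d ^ n" "d ^ n" _ "d ^ n"] psd_carrier psd_mat_powr A B)
  also have "mat_powr A \<alpha> * mat_powr B (1 - \<alpha>) = tensor_list (replicate n (P * Q))"
    unfolding A_def B_def mat_powr_tensor_power[OF \<rho>] mat_powr_tensor_power[OF \<sigma>]
    using tensor_power_mult[OF Pc Qc] by (simp add: P_def Q_def)
  finally have "mat_trace (mat_powr A \<alpha> * mat_powr (complex_of_real c \<cdot>\<^sub>m B) (1 - \<alpha>))
    = complex_of_real (c powr (1 - \<alpha>)) * complex_of_real t ^ n"
    using mat_trace_smult[OF tensor_power_carrier[of "P * Q" d n]] mat_trace_tensor_power[of "P * Q" d n] Pc Qc
    by (simp add: tPQ)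
  then have rhs: "Re (mat_trace (mat_powr A \<alpha> * mat_powr (complex_of_real c \<cdot>\<^sub>m B) (1 - \<alpha>))) = c powr (1 - \<alpha>) * t ^ n"
    by (simp flip: of_real_power of_real_mult)
  have "T * (complex_of_real c \<cdot>\<^sub>m B) = complex_of_real c \<cdot>\<^sub>m (T * B)"
    by (rule mult_smult_distrib[OF Tc psd_carrier[OF B]])
  then have TB: "Re (mat_trace (T * (complex_of_real c \<cdot>\<^sub>m B))) = c * Re (mat_trace (T * B))"
    using mat_trace_smult[OF square_mult_carrier[OF Tc psd_carrier[OF B]]] by simp
  have nn: "0 \<le> Re (mat_trace ((1\<^sub>m (d ^ n) - T) * A))" "0 \<le> Re (mat_trace (T * B))"
    using psd_trace_mult[OF Tp(2) A] psd_trace_mult[OF Tp(1) B] by (auto simp: less_eq_complex_def)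
  have "c * Re (mat_trace (T * B)) \<le> c powr (1 - \<alpha>) * t ^ n"
    using le nn(1) unfolding rhs TB by linarith
  also have "c powr (1 - \<alpha>) = c * c powr - \<alpha>"
    using c by (simp add: powr_diff powr_minus field_simps)
  finally have "Re (mat_trace (T * B)) \<le> c powr - \<alpha> * t ^ n"
    using c by (simp add: mult.assoc)
  moreover have "Re (mat_trace ((1\<^sub>m (d ^ n) - T) * A)) \<le> c powr (1 - \<alpha>) * t ^ n"
    using le nn(2) c unfolding rhs TB by (smt (verit) mult_nonneg_nonneg)
  ultimately show ?thesis using T unfolding A_def B_def by blast
qed

text \<open>Converts an exponential bound on errors into a rate. Positive \<open>n\<close> suffice
  for an upper limit, and where \<open>x n\<close> is not positive the term is minus
  infinity.\<close>

lemma limsup_elog2_le: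
  assumes "\<And>n. n > 0 \<Longrightarrow> x n \<le> y n" "\<And>n. n > 0 \<Longrightarrow> y n > 0"
    and "\<And>n. n > 0 \<Longrightarrow> log 2 (y n) = real n * C"
  shows "limsup (\<lambda>n. ereal (1 / real n) * elog2 (x n)) \<le> ereal C"
proof (rule Limsup_bounded)
  have "ereal (1 / real n) * elog2 (x n) \<le> ereal C" if n: "n > 0" for n
  proof (cases "x n > 0")
    case True
    then have "log 2 (x n) \<le> real n * C"
      using assms(1,2)[OF n] by (simp flip: assms(3)[OF n])
    then show ?thesis using n True by (simp add: elog2_def field_simps)
  qed (use n in \<open>simp add: elog2_def\<close>)
  then show "eventually (\<lambda>n. ereal (1 / real n) * elog2 (x n) \<le> ereal C) sequentially"
    by (intro eventually_sequentiallyI[of 1]) simp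
qed

lemma limsup_elog2_nonpos:
  assumes "\<And>n. n > 0 \<Longrightarrow> x n \<le> 0"
  shows "limsup (\<lambda>n. ereal (1 / real n) * elog2 (x n)) = -\<infinity>"
proof -
  have "limsup (\<lambda>n. ereal (1 / real n) * elog2 (x n)) \<le> -\<infinity>"
  proof (rule Limsup_bounded)
    have "ereal (1 / real n) * elog2 (x n) \<le> -\<infinity>" if n: "n > 0" for n
      using n assms[OF n] by (simp add: elog2_def)
    then show "eventually (\<lambda>n. ereal (1 / real n) * elog2 (x n) \<le> -\<infinity>) sequentially"
      by (intro eventually_sequentiallyI[of 1]) simp
  qed
  then show ?thesis by simp
qed

lemma error_exponent_PRO_ge_petz:
  assumes N: "N \<in> CPTP dA dB" and M: "M \<in> CPTP dA dB"
    and \<alpha>: "0 < \<alpha>" "\<alpha> < 1" and \<phi>: "\<phi> \<in> density_ops dA"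
  shows "ereal ((\<alpha> - 1) / \<alpha>) * (ereal r - petz_div \<alpha> (N \<phi>) (M \<phi>)) \<le> error_exponent_PRO dA dB r N M"
proof -
  have "psd dA \<phi>" using \<phi> by (simp add: density_ops_def)
  then have \<rho>: "psd dB (N \<phi>)" and \<sigma>: "psd dB (M \<phi>)"
    using CPTP_psd N M by blast+
  define t where "t = Re (mat_trace (mat_powr (N \<phi>) \<alpha> * mat_powr (M \<phi>) (1 - \<alpha>)))"
  have t: "t \<ge> 0"
    using psd_trace_mult[OF psd_mat_powr[OF \<rho>] psd_mat_powr[OF \<sigma>], of \<alpha> "1 - \<alpha>"]
    by (simp add: t_def less_eq_complex_def)
  \<comment> \<open>The exponent n/\<alpha> makes c^(-\<alpha>) t^n equal to 2^(-r n). For t = 0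
    this formula would give 0, so an arbitrary positive value is taken instead.\<close>
  define c where "c n = (if t = 0 then 1 else (t * 2 powr r) powr (real n / \<alpha>))" for n
  have c: "c n > 0" for n using t by (simp add: c_def)
  \<comment> \<open>The rate of the Type-I bound: log(c^(1-\<alpha>) t^n) = n C.\<close>
  define C where "C = (1 - \<alpha>) / \<alpha> * (log 2 t + r) + log 2 t"
  have "\<forall>n. \<exists>T. is_test (dB ^ n) T
    \<and> Re (mat_trace ((1\<^sub>m (dB ^ n) - T) * tensor_list (replicate n (N \<phi>)))) \<le> c n powr (1 - \<alpha>) * t ^ n
    \<and> Re (mat_trace (T * tensor_list (replicate n (M \<phi>)))) \<le> c n powr - \<alpha> * t ^ n"
    using hoeffding_test[OF \<rho> \<sigma> \<alpha> c] unfolding t_def by blast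
  then obtain T where T: "\<And>n. is_test (dB ^ n) (T n)"
    "\<And>n. Re (mat_trace ((1\<^sub>m (dB ^ n) - T n) * tensor_list (replicate n (N \<phi>)))) \<le> c n powr (1 - \<alpha>) * t ^ n"
    "\<And>n. Re (mat_trace (T n * tensor_list (replicate n (M \<phi>)))) \<le> c n powr - \<alpha> * t ^ n"
    by metis
  have out: "product_output L n (\<lambda>_. \<phi>) = tensor_list (replicate n (L \<phi>))" for L n
    by (simp add: product_output_def map_replicate_const)
  define e1 where "e1 n = type1_error dB N n (\<lambda>_. \<phi>) (T n)" for n
  define e2 where "e2 n = type2_error M n (\<lambda>_. \<phi>) (T n)" for n
  have e1: "e1 n \<le> c n powr (1 - \<alpha>) * t ^ n" and e2: "e2 n \<le> c n powr - \<alpha> * t ^ n" for n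
    using T(2,3) by (simp_all add: e1_def e2_def type1_error_def type2_error_def out)
  let ?L1 = "limsup (\<lambda>n. ereal (1 / real n) * elog2 (e1 n))"
  let ?L2 = "limsup (\<lambda>n. ereal (1 / real n) * elog2 (e2 n))"
  have "?L2 \<le> - ereal r \<and> ereal ((\<alpha> - 1) / \<alpha>) * (ereal r - petz_div \<alpha> (N \<phi>) (M \<phi>)) \<le> - ?L1"
  proof (cases "t = 0")
    case True
    \<comment> \<open>Here the divergence is infinite and both errors vanish. The restriction to
      positive \<open>n\<close> is essential because \<open>0 ^ 0 = 1\<close>.\<close>
    have "e1 n \<le> 0" "e2 n \<le> 0" if "n > 0" for n
      using e1[of n] e2[of n] that by (simp_all add: True zero_power)
    then have "?L1 = -\<infinity>" "?L2 = -\<infinity>" by (simp_all only: limsup_elog2_nonpos)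
    then show ?thesis by simp
  next
    case False
    with t have t: "t > 0" by simp
    have lc: "log 2 (c n) = real n / \<alpha> * (log 2 t + r)" for n
      using t by (simp add: c_def log_powr log_mult)
    have "?L2 \<le> ereal (- r)"
    proof (rule limsup_elog2_le[OF e2])
      show "c n powr - \<alpha> * t ^ n > 0" for n using c[of n] t by simp
      have "log 2 (c n powr - \<alpha> * t ^ n) = - \<alpha> * log 2 (c n) + real n * log 2 t" for n
        using c[of n] t by (simp add: log_mult log_powr log_nat_power)
      then show "log 2 (c n powr - \<alpha> * t ^ n) = real n * - r" for n
        using \<alpha> by (simp add: lc field_simps)
    qed
    moreover have "?L1 \<le> ereal C"
    proof (rule limsup_elog2_le[OF e1])
      show "c n powr (1 - \<alpha>) * t ^ n > 0" for n using c[of n] t by simp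
      have "log 2 (c n powr (1 - \<alpha>) * t ^ n) = (1 - \<alpha>) * log 2 (c n) + real n * log 2 t" for n
        using c[of n] t by (simp add: log_mult log_powr log_nat_power)
      then show "log 2 (c n powr (1 - \<alpha>) * t ^ n) = real n * C" for n
        by (simp add: lc C_def algebra_simps)
    qed
    \<comment> \<open>Both sides equal ((\<alpha>-1) r - log t)/\<alpha>, so the rate is exactly the
      claimed exponent.\<close>
    moreover have "(\<alpha> - 1) / \<alpha> * (r - 1 / (\<alpha> - 1) * log 2 t) = - C"
      using \<alpha> by (simp add: C_def field_simps)
    then have "ereal ((\<alpha> - 1) / \<alpha>) * (ereal r - petz_div \<alpha> (N \<phi>) (M \<phi>)) = - ereal C"
      using t by (simp add: petz_div_def Let_def flip: t_def)
    ultimately show ?thesis by (metis ereal_minus_le_minus uminus_ereal.simps(1))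
  qed
  moreover have "\<forall>n. product_strategy dA dB n (\<lambda>_. \<phi>) (T n)"
    using T(1) \<phi> by (simp add: product_strategy_def)
  ultimately show ?thesis
    unfolding error_exponent_PRO_def e1_def e2_def
    by (intro Sup_upper2[of "- ?L1"] CollectI exI[of _ "\<lambda>_ _. \<phi>"] exI[of _ T]) (auto simp: e1_def)
qed

text \<open>Isolates the divergence, infinite values included, so that a bound valid for every input
  passes to the supremum over inputs.\<close>

lemma neg_mult_ereal_diff_le_iff:
  assumes "k < 0"
  shows "ereal k * (ereal r - x) \<le> ereal e \<longleftrightarrow> x \<le> ereal (r - e / k)"
  using assms by (cases x) (auto simp: field_simps)

theorem theorem31:
  fixes N M :: "complex mat \<Rightarrow> complex mat" and dA dB :: nat and r :: real
  assumes "N \<in> CPTP dA dB" and "M \<in> CPTP dA dB" and "r > 0"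
  shows "error_exponent_PRO dA dB r N M \<ge>
    (SUP \<alpha> \<in> {0<..<1 :: real}. ereal ((\<alpha> - 1) / \<alpha>) * (ereal r - channel_petz_div dA \<alpha> N M))"
proof (rule SUP_least)
  fix \<alpha> :: real assume "\<alpha> \<in> {0<..<1}"
  then have \<alpha>: "0 < \<alpha>" "\<alpha> < 1" by auto
  define k where "k = (\<alpha> - 1) / \<alpha>"
  have k: "k < 0" using \<alpha> by (simp add: k_def field_simps)
  have le: "ereal k * (ereal r - petz_div \<alpha> (N \<phi>) (M \<phi>)) \<le> error_exponent_PRO dA dB r N M"
    if "\<phi> \<in> density_ops dA" for \<phi>
    unfolding k_def by (rule error_exponent_PRO_ge_petz[OF assms(1,2) \<alpha> that])
  \<comment> \<open>The expression is increasing in the divergence since k < 0. Comparing with all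
    real upper bounds \<open>e\<close> of the error exponent avoids a case distinction on whether
    that exponent is finite.\<close>
  have "ereal k * (ereal r - channel_petz_div dA \<alpha> N M) \<le> ereal e"
    if "error_exponent_PRO dA dB r N M \<le> ereal e" for e
    unfolding neg_mult_ereal_diff_le_iff[OF k] channel_petz_div_def
    by (rule SUP_least) (use le that in \<open>auto simp flip: neg_mult_ereal_diff_le_iff[OF k] intro: order_trans\<close>)
  then show "ereal ((\<alpha> - 1) / \<alpha>) * (ereal r - channel_petz_div dA \<alpha> N M) \<le> error_exponent_PRO dA dB r N M"
    unfolding k_def by (rule ereal_le_real)
qed

end
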